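(* Let $\lambda>0$ and let $\hbar\in\mathbb C\setminus\{0\}$ satisfy $\frac{\lambda}{\hbar}\notin\mathbb N$. Then for every $R\ge 0$ the star product $*_\hbar$ on $\mathrm{Pol}(\mathbb S^2_\lambda)$ is continuous (as a bilinear map) with respect to the quotient-$T_R$-topology.
   Context: Let $(H,X,Y)$ be the standard basis of $\mathfrak{sl}_2(\mathbb C)$ ($[H,X]=2X$, $[H,Y]=-2Y$, $[X,Y]=H$) and $B$ the Killing form ($B(H,H)=8$, $B(X,Y)=4$, the other pairings of basis elements being $0$). Let $\mu=\frac{\mathrm i\lambda}{8}H\in\mathfrak{su}_2$ (so $B(-\mathrm i\mu,H)=\lambda$), $\mathbb S^2_\lambda=\{\mathrm{Ad}_k\mu: k\in SU(2)\}\subseteq\mathfrak{su}_2$ and $\psi_\mu(k)=\mathrm{Ad}_k\mu$. $\mathrm{Pol}(\mathbb S^2_\lambda)$ is the algebra of restrictions to $\mathbb S^2_\lambda$ of complex-valued polynomials on $\mathfrak{su}_2$. Star product: for $\hbar\notin\{0,\lambda,\frac\lambda2,\frac\lambda3,\dots\}$ and $p,q\in\mathrm{Pol}(\mathbb S^2_\lambda)$, $p*_\hbar q\in\mathrm{Pol}(\mathbb S^2_\lambda)$ is defined by $$(p*_\hbar q)\circ\psi_\mu=\sum_{n=0}^\infty\frac{(-1)^n\hbar^n}{n!\,\lambda(\lambda-\hbar)\cdots(\lambda-(n-1)\hbar)}\,(Y^{\mathrm{left}})^n(p\circ\psi_\mu)\cdot(X^{\mathrm{left}})^n(q\circ\psi_\mu),$$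 a finite sum, where for $Z\in\mathfrak{su}_2$, $(Z^{\mathrm{left}}f)(k)=\frac{d}{dt}|_{t=0}f(k\exp(tZ))$, extended complex linearly to $Z\in\mathfrak{sl}_2(\mathbb C)$. $T_R$-topology: for a finite-dimensional complex vector space $V$ with basis $e_1,\dots,e_n$ and corresponding $1$-norm $\|\cdot\|_1$, it is the locally convex topology on the symmetric algebra $\mathrm S^\bullet(V)$ given by the norms $(C\|\cdot\|_1)_R\big(\sum_{I\in\mathbb N_0^n}a_Ie_1^{I_1}\cdots e_n^{I_n}\big)=\sum_I(|I|!)^RC^{|I|}|a_I|$ for all $C\ge1$. Quotient-$T_R$-topology: for $Z\in\mathfrak{sl}_2(\mathbb C)$ put $Z^\flat=B(Z,\cdot)$. Give $\mathrm{Pol}(\mathfrak{sl}_2(\mathbb C))\cong\mathrm S^\bullet(\mathfrak{sl}_2(\mathbb C)^* )$ (complex polynomials in $H^\flat,X^\flat,Y^\flat$) the $T_R$-topology for the basis $H^\flat,X^\flat,Y^\flat$. Let $\mathcal I_{\mathrm{van}}$ be the ideal of those polynomials vanishing on $\mathbb S^2_\lambda$; restriction identifies $\mathrm{Pol}(\mathfrak{sl}_2(\mathbb C))/\mathcal I_{\mathrm{van}}$ with $\mathrm{Pol}(\mathbb S^2_\lambda)$, and the quotient-$T_R$-topology is the quotient topology. *)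

theory Defs
  imports "HOL-Analysis.Analysis" "HOL-Library.Poly_Mapping"
begin

type_synonym mat2 = "complex^2^2"

definition conj_transpose :: "mat2 \<Rightarrow> mat2"
  where "conj_transpose A = (\<chi> i j. cnj (A $ j $ i))"

definition SU2 :: "mat2 set"
  where "SU2 = {k. conj_transpose k ** k = mat 1 \<and> det k = 1}"

definition sl2_H :: mat2
  where "sl2_H = vector [vector [1, 0], vector [0, -1]]"

definition sl2_X :: mat2
  where "sl2_X = vector [vector [0, 1], vector [0, 0]]"

definition sl2_Y :: mat2
  where "sl2_Y = vector [vector [0, 0], vector [1, 0]]"

definition sl2_basis :: "3 \<Rightarrow> mat2"
  where "sl2_basis i = vector [sl2_H, sl2_X, sl2_Y] $ i"

definition lie_bracket :: "mat2 \<Rightarrow> mat2 \<Rightarrow> mat2"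
  where "lie_bracket A B = A ** B - B ** A"

text \<open>The coordinates of a traceless matrix in the basis \<open>(H, X, Y)\<close>.\<close>

definition sl2_coord :: "mat2 \<Rightarrow> 3 \<Rightarrow> complex"
  where "sl2_coord Z i = vector [Z $ 1 $ 1, Z $ 1 $ 2, Z $ 2 $ 1] $ i"

text \<open>The trace of \<open>ad Z \<circ> ad W\<close> on traceless matrices, computed in the basis \<open>(H, X, Y)\<close>.\<close>

definition killing_form :: "mat2 \<Rightarrow> mat2 \<Rightarrow> complex"
  where "killing_form Z W =
    (\<Sum>i\<in>UNIV. sl2_coord (lie_bracket Z (lie_bracket W (sl2_basis i))) i)"

text \<open>Multiplication by the scalar matrix \<open>mat c\<close> is scalar multiplication by \<open>c\<close>.\<close>

definition mu :: "real \<Rightarrow> mat2"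
  where "mu lam = mat (\<i> * complex_of_real lam / 8) ** sl2_H"

definition Ad :: "mat2 \<Rightarrow> mat2 \<Rightarrow> mat2"
  where "Ad k Z = k ** Z ** matrix_inv k"

definition psi :: "real \<Rightarrow> mat2 \<Rightarrow> mat2"
  where "psi lam k = Ad k (mu lam)"

definition sphere2 :: "real \<Rightarrow> mat2 set"
  where "sphere2 lam = psi lam ` SU2"

text \<open>
  Functions on the sphere are extensional functions on \<^typ>\<open>mat2\<close>.  The sphere lies in the real
  subspace of traceless skew-Hermitian matrices, and the complex-valued polynomials on a real
  subspace are the restrictions of those on the ambient real vector space \<^typ>\<open>mat2\<close>.
\<close>

definition Pol_sphere :: "real \<Rightarrow> (mat2 \<Rightarrow> complex) set"
  where "Pol_sphere lam = {restrict p (sphere2 lam) |p. polynomial_function p}"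

definition mat_exp :: "mat2 \<Rightarrow> mat2"
  where "mat_exp A = suminf (\<lambda>n. (1 / fact n) *\<^sub>R ((**) A ^^ n) (mat 1))"

definition left_field_real :: "mat2 \<Rightarrow> (mat2 \<Rightarrow> complex) \<Rightarrow> mat2 \<Rightarrow> complex"
  where "left_field_real Z f k = vector_derivative (\<lambda>t. f (k ** mat_exp (t *\<^sub>R Z))) (at 0)"

text \<open>
  Every matrix \<open>Z\<close> is \<open>A + \<i> B\<close> for the unique skew-Hermitian matrices
  \<open>A = (Z - Z\<^sup>*) / 2\<close> and \<open>B = (Z + Z\<^sup>*) / (2 \<i>)\<close>, which are traceless if \<open>Z\<close> is.
\<close>

definition left_field :: "mat2 \<Rightarrow> (mat2 \<Rightarrow> complex) \<Rightarrow> mat2 \<Rightarrow> complex"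
  where "left_field Z f k =
    left_field_real (mat (1 / 2) ** (Z - conj_transpose Z)) f k
    + \<i> * left_field_real (mat (1 / (2 * \<i>)) ** (Z + conj_transpose Z)) f k"

definition star :: "real \<Rightarrow> complex \<Rightarrow> (mat2 \<Rightarrow> complex) \<Rightarrow> (mat2 \<Rightarrow> complex) \<Rightarrow> mat2 \<Rightarrow> complex"
  where "star lam hbar p q = (THE r. r \<in> Pol_sphere lam \<and>
    (\<forall>k\<in>SU2. (r \<circ> psi lam) k =
      suminf (\<lambda>n. (-1) ^ n * hbar ^ n
              / (fact n * (\<Prod>j<n. complex_of_real lam - of_nat j * hbar))
            * (left_field sl2_Y ^^ n) (p \<circ> psi lam) k
            * (left_field sl2_X ^^ n) (q \<circ> psi lam) k)))"

text \<open>
  The symmetric algebra of a complex vector space with basis indexed by \<^typ>\<open>'n\<close>: finitely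
  supported families of coefficients of monomials, which are given by their exponents.
\<close>

type_synonym 'n sym_alg = "('n \<Rightarrow>\<^sub>0 nat) \<Rightarrow>\<^sub>0 complex"

definition multi_deg :: "('n::finite \<Rightarrow>\<^sub>0 nat) \<Rightarrow> nat"
  where "multi_deg I = (\<Sum>i\<in>UNIV. Poly_Mapping.lookup I i)"

definition TR_norm :: "real \<Rightarrow> real \<Rightarrow> 'n::finite sym_alg \<Rightarrow> real"
  where "TR_norm R C p =
    (\<Sum>I\<in>Poly_Mapping.keys p. fact (multi_deg I) powr R * C ^ multi_deg I * norm (Poly_Mapping.lookup p I))"

definition TR_topology :: "real \<Rightarrow> 'n::finite sym_alg topology"
  where "TR_topology R =
    topology_generated_by {{q. TR_norm R C (q - p) < e} |p C e. C \<ge> 1 \<and> e > 0}"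

text \<open>The \<open>i\<close>-th generator is the linear form \<open>B(b\<^sub>i, \<cdot>)\<close> for the basis \<open>b = (H, X, Y)\<close>.\<close>

definition pol_eval :: "3 sym_alg \<Rightarrow> mat2 \<Rightarrow> complex"
  where "pol_eval p Z =
    (\<Sum>I\<in>Poly_Mapping.keys p. Poly_Mapping.lookup p I * (\<Prod>i\<in>UNIV. killing_form (sl2_basis i) Z ^ Poly_Mapping.lookup I i))"

definition pol_restrict :: "real \<Rightarrow> 3 sym_alg \<Rightarrow> mat2 \<Rightarrow> complex"
  where "pol_restrict lam p = restrict (pol_eval p) (sphere2 lam)"

text \<open>
  The quotient topology modulo the vanishing ideal of the sphere, carried over to the sphere:
  the final topology for the restriction map, whose fibres are the cosets of that ideal.
\<close>

definition quotient_TR_topology :: "real \<Rightarrow> real \<Rightarrow> (mat2 \<Rightarrow> complex) topology"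
  where "quotient_TR_topology lam R = topology (\<lambda>U. U \<subseteq> Pol_sphere lam \<and>
    openin (TR_topology R) (pol_restrict lam -` U))"

lemma killing_form_basis:
  "killing_form sl2_H sl2_H = 8" "killing_form sl2_X sl2_Y = 4" "killing_form sl2_Y sl2_X = 4"
  "killing_form sl2_H sl2_X = 0" "killing_form sl2_X sl2_H = 0"
  "killing_form sl2_H sl2_Y = 0" "killing_form sl2_Y sl2_H = 0"
  "killing_form sl2_X sl2_X = 0" "killing_form sl2_Y sl2_Y = 0"
  by (simp_all add: killing_form_def lie_bracket_def sl2_coord_def sl2_basis_def sum_3
      sl2_H_def sl2_X_def sl2_Y_def matrix_matrix_mult_def sum_2)

lemma killing_form_mu: "killing_form (mat (- \<i>) ** mu lam) sl2_H = complex_of_real lam"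
  by (simp add: killing_form_def lie_bracket_def sl2_coord_def sl2_basis_def sum_3 mu_def mat_def
      sl2_H_def sl2_X_def sl2_Y_def matrix_matrix_mult_def sum_2)

lemma openin_quotient_TR_topology:
  "openin (quotient_TR_topology lam R) U \<longleftrightarrow>
    U \<subseteq> Pol_sphere lam \<and> openin (TR_topology R) (pol_restrict lam -` U)"
proof -
  have "istopology (\<lambda>U. U \<subseteq> Pol_sphere lam \<and> openin (TR_topology R) (pol_restrict lam -` U))"
    by (auto simp: istopology_def vimage_Int vimage_Union)
  then show ?thesis
    by (simp add: quotient_TR_topology_def)
qed

end

theory Submission
  imports Defs
begin

text \<open>
  Write \<open>a, b, c, d\<close> for the entries of \<open>k \<in> SU(2)\<close>.  The generators \<open>H\<^sup>\<flat>, X\<^sup>\<flat>, Y\<^sup>\<flat>\<close> pull back along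
  \<open>\<psi>\<close> to \<open>\<i> \<lambda> (ad + bc)\<close>, \<open>\<i> \<lambda> cd\<close>, \<open>- \<i> \<lambda> ab\<close>, while \<open>Y\<^sup>l\<^sup>e\<^sup>f\<^sup>t = b \<partial>\<^sub>a + d \<partial>\<^sub>c\<close> and
  \<open>X\<^sup>l\<^sup>e\<^sup>f\<^sup>t = a \<partial>\<^sub>b + c \<partial>\<^sub>d\<close>.  A monomial of degree \<open>m\<close> thus becomes a polynomial of degree \<open>m\<close> in
  \<open>(a, c)\<close> and of degree \<open>m\<close> in \<open>(b, d)\<close>, and its \<open>n\<close>-th derivative increases the 1-norm of the
  coefficients by at most \<open>m! / (m - n)! \<le> 2\<^sup>m n!\<close>.  As \<open>\<lambda> / \<hbar>\<close> is not a natural number, the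
  \<open>n\<close>-th coefficient of the star product is at most \<open>D\<^sup>n / n!\<^sup>2\<close>, which absorbs these factorials.
  Pairing an entry of the first column with one of the second turns the resulting polynomial of
  bidegree \<open>(m + m', m + m')\<close> back into a polynomial of degree at most \<open>m + m'\<close> on the sphere whose
  1-norm grows only exponentially.  Since \<open>(m + m')! \<le> 2\<^bsup>m + m'\<^esup> m! m'!\<close>, this bounds the \<open>T\<^sub>R\<close>-norms of
  a representative of \<open>p * q\<close> by products of \<open>T\<^sub>R\<close>-norms of representatives of \<open>p\<close> and \<open>q\<close>, and
  continuity follows because the quotient map is open.
\<close>

section \<open>Norms on the symmetric algebra\<close>

text \<open>Evaluation at a point and, applied twice, the bilinear extension \<open>star_rep\<close>
  are both of this form, so their additivity is proved once.\<close>

definition lin_ext :: "('a \<Rightarrow> complex) \<Rightarrow> ('a \<Rightarrow>\<^sub>0 complex) \<Rightarrow> complex"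
  where "lin_ext w p = (\<Sum>I\<in>Poly_Mapping.keys p. Poly_Mapping.lookup p I * w I)"

lemma lin_ext_superset:
  assumes "finite A" "Poly_Mapping.keys p \<subseteq> A"
  shows "lin_ext w p = (\<Sum>I\<in>A. Poly_Mapping.lookup p I * w I)"
  unfolding lin_ext_def
  by (rule sum.mono_neutral_left) (use assms in \<open>auto simp: in_keys_iff\<close>)

lemma lin_ext_add: "lin_ext w (p + q) = lin_ext w p + lin_ext w q"
proof -
  let ?A = "Poly_Mapping.keys p \<union> Poly_Mapping.keys q"
  have "lin_ext w (p + q) = (\<Sum>I\<in>?A. Poly_Mapping.lookup (p + q) I * w I)"
    by (rule lin_ext_superset) (use Poly_Mapping.keys_add[of p q] in auto)
  also have "\<dots> = lin_ext w p + lin_ext w q"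
    by (simp add: lin_ext_superset[of ?A] lookup_add distrib_right sum.distrib)
  finally show ?thesis .
qed

lemma lin_ext_diff: "lin_ext w (p - q) = lin_ext w p - lin_ext w q"
  using lin_ext_add[of w "p - q" q] by simp

lemma lin_ext_diff_weight: "lin_ext (\<lambda>I. v I - w I) p = lin_ext v p - lin_ext w p"
  by (simp add: lin_ext_def right_diff_distrib sum_subtractf)

lemma lin_ext_single: "lin_ext w (Poly_Mapping.single I z) = z * w I"
  by (cases "z = 0") (simp_all add: lin_ext_def)

definition monomial_fun :: "(3 \<Rightarrow>\<^sub>0 nat) \<Rightarrow> mat2 \<Rightarrow> complex"
  where "monomial_fun I Z = (\<Prod>i\<in>UNIV. killing_form (sl2_basis i) Z ^ Poly_Mapping.lookup I i)"

lemma pol_eval_lin_ext: "pol_eval p Z = lin_ext (\<lambda>I. monomial_fun I Z) p"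
  by (simp add: pol_eval_def lin_ext_def monomial_fun_def)

lemma monomial_fun_add: "monomial_fun (I + J) Z = monomial_fun I Z * monomial_fun J Z"
  by (simp add: monomial_fun_def lookup_add power_add prod.distrib)

lemma monomial_fun_single:
  "monomial_fun (Poly_Mapping.single i 1) Z = killing_form (sl2_basis i) Z"
proof -
  have "monomial_fun (Poly_Mapping.single i 1) Z
      = (\<Prod>j\<in>UNIV. if j = i then killing_form (sl2_basis i) Z else 1)"
    unfolding monomial_fun_def by (intro prod.cong) (auto simp: lookup_single when_def)
  then show ?thesis by simp
qed

lemma monomial_fun_0: "monomial_fun 0 Z = 1"
  by (simp add: monomial_fun_def)

lemma multi_deg_add: "multi_deg (I + J) = multi_deg I + multi_deg J"
  by (simp add: multi_deg_def lookup_add sum.distrib)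

lemma multi_deg_0: "multi_deg 0 = 0"
  by (simp add: multi_deg_def)

lemma multi_deg_single: "multi_deg (Poly_Mapping.single i n) = n"
proof -
  have "multi_deg (Poly_Mapping.single i n) = (\<Sum>j\<in>UNIV. if j = i then n else 0)"
    unfolding multi_deg_def by (intro sum.cong) (auto simp: lookup_single when_def)
  then show ?thesis by simp
qed

lemma TR_norm_superset:
  assumes "finite A" "Poly_Mapping.keys p \<subseteq> A"
  shows "TR_norm R C p =
    (\<Sum>I\<in>A. fact (multi_deg I) powr R * C ^ multi_deg I * norm (Poly_Mapping.lookup p I))"
  unfolding TR_norm_def
  by (rule sum.mono_neutral_left) (use assms in \<open>auto simp: in_keys_iff\<close>)

lemma TR_norm_nonneg: "0 \<le> C \<Longrightarrow> 0 \<le> TR_norm R C p"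
  unfolding TR_norm_def by (intro sum_nonneg mult_nonneg_nonneg) auto

lemma TR_norm_0: "TR_norm R C 0 = 0"
  by (simp add: TR_norm_def)

lemma TR_norm_add:
  assumes "0 \<le> C"
  shows "TR_norm R C (p + q) \<le> TR_norm R C p + TR_norm R C q"
proof -
  let ?A = "Poly_Mapping.keys p \<union> Poly_Mapping.keys q"
  let ?w = "\<lambda>I. fact (multi_deg I) powr R * C ^ multi_deg I"
  have "TR_norm R C (p + q) = (\<Sum>I\<in>?A. ?w I * norm (Poly_Mapping.lookup (p + q) I))"
    by (rule TR_norm_superset) (use Poly_Mapping.keys_add[of p q] in auto)
  also have "\<dots> \<le> (\<Sum>I\<in>?A. ?w I * (norm (Poly_Mapping.lookup p I) + norm (Poly_Mapping.lookup q I)))"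
    using assms by (intro sum_mono mult_left_mono) (auto simp: lookup_add norm_triangle_ineq)
  also have "\<dots> = TR_norm R C p + TR_norm R C q"
    by (simp add: TR_norm_superset[of ?A] distrib_left sum.distrib)
  finally show ?thesis .
qed

lemma TR_norm_sum:
  assumes "0 \<le> C"
  shows "TR_norm R C (\<Sum>i\<in>A. f i) \<le> (\<Sum>i\<in>A. TR_norm R C (f i))"
proof (induction A rule: infinite_finite_induct)
  case (insert i A)
  then show ?case using TR_norm_add[OF assms, of R "f i" "sum f A"] by simp
qed (simp_all add: TR_norm_0)

lemma TR_norm_mono:
  assumes "0 \<le> C" "C \<le> C'"
  shows "TR_norm R C p \<le> TR_norm R C' p"
  unfolding TR_norm_def
  using assms by (intro sum_mono mult_right_mono mult_left_mono power_mono) auto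

lemma TR_norm_single:
  "TR_norm R C (Poly_Mapping.single I z) = fact (multi_deg I) powr R * C ^ multi_deg I * norm z"
  by (cases "z = 0") (simp_all add: TR_norm_def)

text \<open>Balls alone suffice, without finite intersections, because the norms increase with
  \<open>C\<close>: the norm for the larger of two constants dominates both. The triangle inequality
  recentres a ball at any of its points.\<close>

lemma openin_TR_topology:
  "openin (TR_topology R) U \<longleftrightarrow>
    (\<forall>p\<in>U. \<exists>C\<ge>1. \<exists>e>0. \<forall>q. TR_norm R C (q - p) < e \<longrightarrow> q \<in> U)" (is "_ \<longleftrightarrow> ?rhs U")
proof
  assume "openin (TR_topology R) U"
  then have "generate_topology_on {{q. TR_norm R C (q - p) < e} |p C e. C \<ge> 1 \<and> e > 0} U"
    by (simp add: TR_topology_def openin_topology_generated_by_iff)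
  then show "?rhs U"
  proof induction
    case (Int U V)
    show ?case
    proof
      fix p assume p: "p \<in> U \<inter> V"
      obtain C e where C: "C \<ge> 1" "e > 0" "\<And>q. TR_norm R C (q - p) < e \<Longrightarrow> q \<in> U"
        using Int.IH(1) p by (metis IntD1)
      obtain C' e' where C': "C' \<ge> 1" "e' > 0" "\<And>q. TR_norm R C' (q - p) < e' \<Longrightarrow> q \<in> V"
        using Int.IH(2) p by (metis IntD2)
      have "q \<in> U \<inter> V" if "TR_norm R (max C C') (q - p) < min e e'" for q
        using that C C' TR_norm_mono[of C "max C C'" R "q - p"] TR_norm_mono[of C' "max C C'" R "q - p"]
        by auto
      then show "\<exists>C\<ge>1. \<exists>e>0. \<forall>q. TR_norm R C (q - p) < e \<longrightarrow> q \<in> U \<inter> V"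
        using C C' by (intro exI[of _ "max C C'"] conjI exI[of _ "min e e'"]) auto
    qed
  next
    case (UN K)
    then show ?case by (meson UnionE UnionI)
  next
    case (Basis s)
    then obtain p0 C e where s: "s = {q. TR_norm R C (q - p0) < e}" "C \<ge> 1" "e > 0" by auto
    show ?case
    proof
      fix p assume p: "p \<in> s"
      have "q \<in> s" if "TR_norm R C (q - p) < e - TR_norm R C (p - p0)" for q
        using that TR_norm_add[of C R "q - p" "p - p0"] s by simp
      then show "\<exists>C\<ge>1. \<exists>e>0. \<forall>q. TR_norm R C (q - p) < e \<longrightarrow> q \<in> s"
        using s p by (intro exI[of _ C] conjI exI[of _ "e - TR_norm R C (p - p0)"]) auto
    qed
  qed auto
next
  assume U: "?rhs U"
  show "openin (TR_topology R) U"
  proof (subst openin_subopen, intro ballI)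
    fix p assume "p \<in> U"
    then obtain C e where C: "C \<ge> 1" "e > 0" "\<And>q. TR_norm R C (q - p) < e \<Longrightarrow> q \<in> U"
      using U by metis
    have "openin (TR_topology R) {q. TR_norm R C (q - p) < e}"
      unfolding TR_topology_def using C by (intro topology_generated_by_Basis) auto
    then show "\<exists>T. openin (TR_topology R) T \<and> p \<in> T \<and> T \<subseteq> U"
      using C by (intro exI[of _ "{q. TR_norm R C (q - p) < e}"]) (auto simp: TR_norm_0)
  qed
qed

text \<open>The parameters bound the degree and the 1-norm of the coefficients.\<close>

inductive polsum :: "nat \<Rightarrow> real \<Rightarrow> (mat2 \<Rightarrow> complex) \<Rightarrow> bool" where
  polsum_monomial: "multi_deg I \<le> u \<Longrightarrow> cmod z \<le> N \<Longrightarrow> polsum u N (\<lambda>Z. z * monomial_fun I Z)"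
| polsum_add: "polsum u N F \<Longrightarrow> polsum u M G \<Longrightarrow> polsum u (N + M) (\<lambda>Z. F Z + G Z)"

lemma polsum_mono:
  assumes "polsum u N F" "u \<le> v" "N \<le> M"
  shows "polsum v M F"
  using assms
proof (induction arbitrary: M)
  case (polsum_add u N F N' G)
  \<comment> \<open>The second summand absorbs all the slack in the bound.\<close>
  then have "polsum v (N + (M - N)) (\<lambda>Z. F Z + G Z)"
    by (intro polsum.polsum_add) auto
  then show ?case by simp
qed (auto intro: polsum.polsum_monomial)

lemma polsum_mult_monomial:
  assumes "polsum v M G" "multi_deg I \<le> u" "cmod z \<le> N"
  shows "polsum (u + v) (N * M) (\<lambda>Z. z * monomial_fun I Z * G Z)"
  using assms
proof induction
  case (polsum_monomial J v z' M)
  have "polsum (u + v) (N * M) (\<lambda>Z. (z * z') * monomial_fun (I + J) Z)"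
    using polsum_monomial order_trans[OF norm_ge_zero, of z N]
    by (intro polsum.polsum_monomial) (auto simp: multi_deg_add norm_mult intro!: mult_mono)
  then show ?case by (simp add: monomial_fun_add mult_ac)
next
  case (polsum_add v M F M' G)
  then have "polsum (u + v) (N * M + N * M')
      (\<lambda>Z. z * monomial_fun I Z * F Z + z * monomial_fun I Z * G Z)"
    by (intro polsum.polsum_add) auto
  then show ?case by (simp add: distrib_left)
qed

lemma polsum_mult:
  assumes "polsum u N F" "polsum v M G"
  shows "polsum (u + v) (N * M) (\<lambda>Z. F Z * G Z)"
  using assms
proof induction
  case (polsum_monomial I u z N)
  then show ?case using polsum_mult_monomial by blast
next
  case (polsum_add u N F N' F')
  then have "polsum (u + v) (N * M + N' * M) (\<lambda>Z. F Z * G Z + F' Z * G Z)"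
    by (intro polsum.polsum_add) auto
  then show ?case by (simp add: distrib_right)
qed

lemma polsum_const: "polsum 0 (cmod z) (\<lambda>Z. z)"
  using polsum_monomial[of 0 0 z "cmod z"] by (simp add: multi_deg_0 monomial_fun_0)

lemma polsum_killing_form: "polsum 1 1 (killing_form (sl2_basis i))"
  using polsum_monomial[of "Poly_Mapping.single i 1" 1 1 1]
  unfolding monomial_fun_single by (simp add: multi_deg_single)

text \<open>For \<open>R \<ge> 0\<close> and \<open>C \<ge> 1\<close> the weight of a monomial grows
  with its degree, so the weight at the degree bound \<open>u\<close> serves for every
  summand.\<close>

lemma polsum_repr:
  assumes "polsum u N F" "R \<ge> 0" "C \<ge> 1"
  shows "\<exists>r. pol_eval r = F \<and> TR_norm R C r \<le> fact u powr R * C ^ u * N"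
  using assms
proof induction
  case (polsum_monomial I u z N)
  have "pol_eval (Poly_Mapping.single I z) = (\<lambda>Z. z * monomial_fun I Z)"
    by (simp add: fun_eq_iff pol_eval_lin_ext lin_ext_single)
  moreover have "fact (multi_deg I) powr R * C ^ multi_deg I * cmod z \<le> fact u powr R * C ^ u * N"
    using polsum_monomial
    by (intro mult_mono powr_mono2 power_increasing fact_mono) auto
  ultimately show ?case by (intro exI[of _ "Poly_Mapping.single I z"]) (simp add: TR_norm_single)
next
  case (polsum_add u N F M G)
  then obtain r s where
    r: "pol_eval r = F" "TR_norm R C r \<le> fact u powr R * C ^ u * N" and
    s: "pol_eval s = G" "TR_norm R C s \<le> fact u powr R * C ^ u * M" by blast
  have "pol_eval (r + s) = (\<lambda>Z. F Z + G Z)"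
    using r s by (auto simp: fun_eq_iff pol_eval_lin_ext lin_ext_add)
  moreover have "TR_norm R C (r + s) \<le> fact u powr R * C ^ u * (N + M)"
    using TR_norm_add[of C R r s] r s polsum_add.prems by (simp add: distrib_left)
  ultimately show ?case by blast
qed

section \<open>Left invariant vector fields on SU(2)\<close>

lemma mat2_eq_iff:
  "(A::mat2) = B \<longleftrightarrow> A$1$1 = B$1$1 \<and> A$1$2 = B$1$2 \<and> A$2$1 = B$2$1 \<and> A$2$2 = B$2$2"
  by (auto simp: vec_eq_iff forall_2)

lemma mat2_mult:
  fixes A B :: mat2
  shows "(A ** B)$i$j = A$i$1 * B$1$j + A$i$2 * B$2$j"
  by (simp add: matrix_matrix_mult_def sum_2)

lemma mat2_mat:
  "(mat z :: mat2)$1$1 = z" "(mat z :: mat2)$1$2 = 0" "(mat z :: mat2)$2$1 = 0" "(mat z :: mat2)$2$2 = z"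
  by (simp_all add: mat_def)

text \<open>The conjugate transpose is the inverse, which for determinant 1 is the adjugate; the
  last two equations compare their entries.\<close>

lemma SU2_entries:
  assumes "k \<in> SU2"
  shows "k$1$1 * k$2$2 - k$1$2 * k$2$1 = 1" "k$2$2 = cnj (k$1$1)" "k$2$1 = - cnj (k$1$2)"
proof -
  have det: "k$1$1 * k$2$2 - k$1$2 * k$2$1 = 1"
    using assms by (simp add: SU2_def det_2)
  have 1: "cnj (k$1$1) * k$1$1 + cnj (k$2$1) * k$2$1 = 1"
    "cnj (k$1$1) * k$1$2 + cnj (k$2$1) * k$2$2 = 0"
    "cnj (k$1$2) * k$1$1 + cnj (k$2$2) * k$2$1 = 0"
    "cnj (k$1$2) * k$1$2 + cnj (k$2$2) * k$2$2 = 1"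
    using assms by (auto simp: SU2_def conj_transpose_def mat2_eq_iff mat2_mult mat2_mat)
  show "k$1$1 * k$2$2 - k$1$2 * k$2$1 = 1" by (rule det)
  show "k$2$2 = cnj (k$1$1)" using det 1 by algebra
  have "cnj (k$1$2) = - (k$2$1)" using det 1 by algebra
  then show "k$2$1 = - cnj (k$1$2)" by simp
qed

lemma matrix_inv_SU2:
  assumes "k \<in> SU2"
  shows "matrix_inv k = vector [vector [k$2$2, - (k$1$2)], vector [- (k$2$1), k$1$1]]"
proof -
  let ?B = "vector [vector [k$2$2, - (k$1$2)], vector [- (k$2$1), k$1$1]] :: mat2"
  have *: "k ** ?B = mat 1" "?B ** k = mat 1"
    using SU2_entries(1)[OF assms] by (auto simp: mat2_eq_iff mat2_mult mat2_mat algebra_simps)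
  \<comment> \<open>\<open>matrix_inv\<close> is a choice by \<open>SOME\<close>; it is identified
    with the adjugate by uniqueness of inverses.\<close>
  have "matrix_inv k ** k = mat 1"
    unfolding matrix_inv_def by (rule someI2[of _ ?B]) (use * in auto)
  then have "?B = (matrix_inv k ** k) ** ?B" by simp
  also have "\<dots> = matrix_inv k"
    unfolding matrix_mul_assoc[symmetric] *(1) by simp
  finally show ?thesis by simp
qed

lemma psi_entries:
  assumes "k \<in> SU2"
  shows "psi lam k $1$1 = \<i> * lam / 8 * (k$1$1 * k$2$2 + k$1$2 * k$2$1)"
    "psi lam k $1$2 = - (\<i> * lam / 4 * (k$1$1 * k$1$2))"
    "psi lam k $2$1 = \<i> * lam / 4 * (k$2$1 * k$2$2)"
    "psi lam k $2$2 = - (\<i> * lam / 8 * (k$1$1 * k$2$2 + k$1$2 * k$2$1))"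
  by (simp_all add: psi_def Ad_def mu_def matrix_inv_SU2[OF assms] mat2_mult mat2_mat sl2_H_def
      field_simps)

lemma killing_form_entries:
  "killing_form (sl2_basis 1) Z = 4 * (Z$1$1 - Z$2$2)"
  "killing_form (sl2_basis 2) Z = 4 * Z$2$1"
  "killing_form (sl2_basis 3) Z = 4 * Z$1$2"
  by (simp_all add: killing_form_def lie_bracket_def sl2_coord_def sl2_basis_def sum_3 mat2_mult
      sl2_H_def sl2_X_def sl2_Y_def algebra_simps)

lemma killing_form_psi:
  assumes "k \<in> SU2"
  shows "killing_form (sl2_basis 1) (psi lam k) = \<i> * lam * (k$1$1 * k$2$2 + k$1$2 * k$2$1)"
    "killing_form (sl2_basis 2) (psi lam k) = \<i> * lam * (k$2$1 * k$2$2)"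
    "killing_form (sl2_basis 3) (psi lam k) = - (\<i> * lam * (k$1$1 * k$1$2))"
  by (simp_all add: killing_form_entries psi_entries[OF assms] field_simps)

text \<open>The matrices by which \<open>left_field\<close> splits X and Y: the part
  \<open>A\<close> is \<open>skew (1/2)\<close> for X and \<open>skew (-1/2)\<close> for Y, and the
  part \<open>B\<close> is \<open>skew (-\<i>/2)\<close> for both. All of these have
  \<open>cmod w = 1/2\<close>.\<close>

definition skew :: "complex \<Rightarrow> mat2"
  where "skew w = vector [vector [0, w], vector [- cnj w, 0]]"

lemma skew_entries:
  "skew w $1$1 = 0" "skew w $1$2 = w" "skew w $2$1 = - cnj w" "skew w $2$2 = 0"
  by (simp_all add: skew_def)

text \<open>For \<open>cmod w = 1/2\<close> the square of \<open>skew w\<close> is -1/4 times the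
  identity, so the even and odd parts of the exponential series are the cosine and sine series at
  \<open>t/2\<close>.\<close>

lemma mat_exp_skew:
  assumes w: "cmod w = 1 / 2"
  shows "mat_exp (t *\<^sub>R skew w) = cos (t / 2) *\<^sub>R mat 1 + (2 * sin (t / 2)) *\<^sub>R skew w"
proof -
  have ww: "w * cnj w = 1 / 4"
    using complex_norm_square[of w] unfolding w by (simp add: power_divide)
  have pow: "((**) (t *\<^sub>R skew w) ^^ n) (mat 1) =
    (if even n then ((-1) ^ (n div 2) * (t / 2) ^ n) *\<^sub>R mat 1
     else (2 * (-1) ^ ((n - 1) div 2) * (t / 2) ^ n) *\<^sub>R skew w)" for n
  proof (induction n)
    case (Suc n)
    show ?case
    proof (cases "even n")
      case True
      then show ?thesis using Suc
        by (simp add: mat2_eq_iff mat2_mult mat2_mat skew_entries scaleR_conv_of_real[where 'a = complex])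
    next
      case False
      then obtain m where n: "n = 2 * m + 1" by (elim oddE)
      have "((**) (t *\<^sub>R skew w) ^^ Suc n) (mat 1)
          = (t *\<^sub>R skew w) ** ((2 * (-1) ^ m * (t / 2) ^ n) *\<^sub>R skew w)"
        using Suc False n by simp
      also have "\<dots> = ((-1) ^ Suc m * (t / 2) ^ Suc n) *\<^sub>R mat 1"
        using ww
        by (simp add: mat2_eq_iff mat2_mult mat2_mat skew_entries
            scaleR_conv_of_real[where 'a = complex] mult_ac)
      finally show ?thesis using n by simp
    qed
  qed simp
  have summand: "(1 / fact n) *\<^sub>R ((**) (t *\<^sub>R skew w) ^^ n) (mat 1) =
    (cos_coeff n *\<^sub>R (t / 2) ^ n) *\<^sub>R mat 1 + (2 * (sin_coeff n *\<^sub>R (t / 2) ^ n)) *\<^sub>R skew w" for n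
    by (simp add: pow cos_coeff_def sin_coeff_def)
  have "(\<lambda>n. (1 / fact n) *\<^sub>R ((**) (t *\<^sub>R skew w) ^^ n) (mat 1)) sums
    (cos (t / 2) *\<^sub>R mat 1 + (2 * sin (t / 2)) *\<^sub>R skew w)"
    unfolding summand
    by (intro sums_add bounded_linear.sums[OF bounded_linear_scaleR_left] sums_mult
        cos_converges sin_converges)
  then show ?thesis unfolding mat_exp_def by (simp add: sums_iff)
qed

lemma SU2_mult: "k \<in> SU2 \<Longrightarrow> l \<in> SU2 \<Longrightarrow> k ** l \<in> SU2"
proof -
  assume k: "k \<in> SU2" and l: "l \<in> SU2"
  have "conj_transpose (k ** l) = conj_transpose l ** conj_transpose k"
    by (simp add: conj_transpose_def mat2_eq_iff mat2_mult mult.commute)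
  then have "conj_transpose (k ** l) ** (k ** l)
      = conj_transpose l ** (conj_transpose k ** k) ** l"
    by (simp add: matrix_mul_assoc)
  then show ?thesis using k l by (simp add: SU2_def det_mul)
qed

lemma mat_exp_skew_SU2:
  assumes w: "cmod w = 1 / 2"
  shows "mat_exp (t *\<^sub>R skew w) \<in> SU2"
proof -
  have ww: "w * cnj w = 1 / 4"
    using complex_norm_square[of w] unfolding w by (simp add: power_divide)
  have cs: "complex_of_real (cos (t / 2)) * complex_of_real (cos (t / 2))
      + complex_of_real (sin (t / 2)) * complex_of_real (sin (t / 2)) = 1"
    by (metis of_real_add of_real_mult of_real_1 sin_cos_squared_add3)
  have ww4: "w * (cnj w * (4 * x)) = x" for x
    using ww by algebra
  show ?thesis
    by (simp add: mat_exp_skew[OF w] SU2_def conj_transpose_def det_2 mat2_eq_iff mat2_mult mat2_mat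
        skew_entries scaleR_conv_of_real[where 'a = complex] algebra_simps cs ww4)
qed

text \<open>The curve along which \<open>f\<close> is differentiated stays in SU(2), so
  \<open>f\<close> may be replaced there by the extension \<open>F\<close>, to which the chain rule
  applies.\<close>

lemma left_field_real_skew:
  assumes w: "cmod w = 1 / 2" and k: "k \<in> SU2"
    and f: "\<And>k. k \<in> SU2 \<Longrightarrow> f k = F k" and F: "(F has_derivative F') (at k)"
  shows "left_field_real (skew w) f k = F' (k ** skew w)"
proof -
  define c where "c = (\<lambda>t. cos (t / 2) *\<^sub>R k + (2 * sin (t / 2)) *\<^sub>R (k ** skew w))"
  have c: "k ** mat_exp (t *\<^sub>R skew w) = c t" for t
    by (simp add: c_def mat_exp_skew[OF w] mat2_eq_iff mat2_mult mat2_mat skew_entries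
        scaleR_conv_of_real[where 'a = complex] algebra_simps)
  have fc: "f (c t) = F (c t)" for t
    using f SU2_mult[OF k mat_exp_skew_SU2[OF w, of t]] by (simp add: c)
  have "(c has_vector_derivative (k ** skew w)) (at 0)"
    unfolding c_def by (auto intro!: derivative_eq_intros)
  then have "((F \<circ> c) has_derivative F' \<circ> (\<lambda>t. t *\<^sub>R (k ** skew w))) (at 0)"
    using F unfolding has_vector_derivative_def by (intro diff_chain_at) (auto simp: c_def)
  moreover have "F' (t *\<^sub>R (k ** skew w)) = t *\<^sub>R F' (k ** skew w)" for t
    using has_derivative_linear[OF F] by (simp add: linear_scale)
  ultimately have "((\<lambda>t. F (c t)) has_vector_derivative F' (k ** skew w)) (at 0)"
    by (simp add: has_vector_derivative_def o_def)
  then show ?thesis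
    unfolding left_field_real_def c fc by (rule vector_derivative_at)
qed

text \<open>Complex differentiability: \<open>has_derivative\<close> only gives a real linear
  derivative, and commuting with \<i> makes it complex linear.\<close>

definition cderiv :: "(mat2 \<Rightarrow> complex) \<Rightarrow> mat2 \<Rightarrow> (mat2 \<Rightarrow> complex) \<Rightarrow> bool"
  where "cderiv F k F' \<longleftrightarrow> (F has_derivative F') (at k) \<and> (\<forall>H. F' (mat \<i> ** H) = \<i> * F' H)"

text \<open>
  Unlike \<^const>\<open>left_field\<close>, which only sees the values on \<open>SU(2)\<close>, this differentiates functions
  of all matrices, so that it acts on polynomials in the matrix entries.
\<close>

definition dfield :: "mat2 \<Rightarrow> (mat2 \<Rightarrow> complex) \<Rightarrow> mat2 \<Rightarrow> complex"
  where "dfield Z F k = frechet_derivative F (at k) (k ** Z)"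

lemma dfield_eq: "cderiv F k F' \<Longrightarrow> dfield Z F k = F' (k ** Z)"
  unfolding cderiv_def dfield_def by (metis frechet_derivative_at)

text \<open>With Z = A + \<i> B for skew-Hermitian A and B, complex linearity of \<open>F'\<close>
  recombines the two real derivatives into one in the direction \<open>k ** Z\<close>.\<close>

lemma left_field_eq:
  assumes "Z = sl2_X \<or> Z = sl2_Y" and k: "k \<in> SU2"
    and f: "\<And>k. k \<in> SU2 \<Longrightarrow> f k = F k" and F: "cderiv F k F'"
  shows "left_field Z f k = F' (k ** Z)"
proof -
  obtain w where w: "cmod w = 1 / 2" "mat (1 / 2) ** (Z - conj_transpose Z) = skew w"
    using assms(1)
  proof
    assume "Z = sl2_X" then show ?thesis
      by (intro that[of "1/2"])
        (simp_all add: sl2_X_def conj_transpose_def mat2_eq_iff mat2_mult mat2_mat skew_entries)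
  next
    assume "Z = sl2_Y" then show ?thesis
      by (intro that[of "- 1/2"])
        (simp_all add: sl2_Y_def conj_transpose_def mat2_eq_iff mat2_mult mat2_mat skew_entries)
  qed
  have v: "mat (1 / (2 * \<i>)) ** (Z + conj_transpose Z) = skew (- \<i> / 2)"
    using assms(1)
    by (auto simp: sl2_X_def sl2_Y_def conj_transpose_def mat2_eq_iff mat2_mult mat2_mat skew_entries)
  have Z: "k ** Z = k ** skew w + mat \<i> ** (k ** skew (- \<i> / 2))"
    unfolding w(2)[symmetric] v[symmetric]
    by (simp add: mat2_eq_iff mat2_mult mat2_mat field_simps)
  have F': "(F has_derivative F') (at k)" "F' (mat \<i> ** H) = \<i> * F' H" for H
    using F by (auto simp: cderiv_def)
  have "left_field Z f k = F' (k ** skew w) + \<i> * F' (k ** skew (- \<i> / 2))"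
    unfolding left_field_def w(2) v
    using left_field_real_skew[OF w(1) k f F'(1)] left_field_real_skew[OF _ k f F'(1), of "- \<i> / 2"]
    by simp
  also have "\<dots> = F' (k ** Z)"
    unfolding Z using F' has_derivative_linear[OF F'(1)] by (simp add: linear_add)
  finally show ?thesis .
qed

section \<open>Bihomogeneous polynomials in the matrix entries\<close>

definition mono4 :: "nat \<Rightarrow> nat \<Rightarrow> nat \<Rightarrow> nat \<Rightarrow> mat2 \<Rightarrow> complex"
  where "mono4 i j k l K = K$1$1 ^ i * K$1$2 ^ j * K$2$1 ^ k * K$2$2 ^ l"

text \<open>
  Bihomogeneous polynomials in the two columns of the matrix; the real parameter bounds the 1-norm
  of the coefficients.
\<close>

inductive bihom :: "nat \<Rightarrow> nat \<Rightarrow> real \<Rightarrow> (mat2 \<Rightarrow> complex) \<Rightarrow> bool" where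
  bihom_zero: "0 \<le> N \<Longrightarrow> bihom u v N (\<lambda>K. 0)"
| bihom_mono4: "u = i + k \<Longrightarrow> v = j + l \<Longrightarrow> cmod z \<le> N \<Longrightarrow> bihom u v N (\<lambda>K. z * mono4 i j k l K)"
| bihom_add: "bihom u v N F \<Longrightarrow> bihom u v M G \<Longrightarrow> bihom u v (N + M) (\<lambda>K. F K + G K)"

lemma bihom_nonneg: "bihom u v N F \<Longrightarrow> 0 \<le> N"
  by (induction rule: bihom.induct) (auto intro: order_trans[OF norm_ge_zero])

text \<open>Turns a vanishing binomial coefficient in the bounds below into the vanishing of
  derivatives whose order exceeds the degree.\<close>

lemma bihom_bound_0: "bihom u v N F \<Longrightarrow> N = 0 \<Longrightarrow> F = (\<lambda>K. 0)"
proof (induction rule: bihom.induct)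
  case (bihom_add u v N F M G)
  then have "N = 0" "M = 0" using bihom_nonneg by (smt (verit))+
  then show ?case using bihom_add by simp
qed auto

lemma bihom_weaken:
  assumes "bihom u v N F" "N \<le> M"
  shows "bihom u v M F"
  using bihom_add[OF assms(1) bihom_zero[of "M - N"]] assms(2) by simp

lemma bihom_mult_mono4:
  assumes "bihom u v M G"
  shows "bihom (i + k + u) (j + l + v) (cmod z * M) (\<lambda>K. z * mono4 i j k l K * G K)"
  using assms
proof (induction rule: bihom.induct)
  case (bihom_zero M u v)
  then show ?case by (auto intro!: bihom.bihom_zero)
next
  case (bihom_mono4 u i' k' v j' l' y M)
  have "bihom (i + k + u) (j + l + v) (cmod z * M)
      (\<lambda>K. z * y * mono4 (i + i') (j + j') (k + k') (l + l') K)"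
    using bihom_mono4 by (intro bihom.bihom_mono4) (auto simp: norm_mult intro: mult_left_mono)
  then show ?case by (simp add: mono4_def power_add mult_ac)
next
  case (bihom_add u v M F M' G)
  then have "bihom (i + k + u) (j + l + v) (cmod z * M + cmod z * M')
      (\<lambda>K. z * mono4 i j k l K * F K + z * mono4 i j k l K * G K)"
    by (intro bihom.bihom_add)
  then show ?case by (simp add: distrib_left)
qed

lemma bihom_mult:
  assumes "bihom u v N F" "bihom u' v' M G"
  shows "bihom (u + u') (v + v') (N * M) (\<lambda>K. F K * G K)"
  using assms
proof (induction rule: bihom.induct)
  case (bihom_zero N u v)
  then show ?case using bihom_nonneg by (auto intro!: bihom.bihom_zero)
next
  case (bihom_mono4 u i k v j l z N)
  then show ?case
    using bihom_weaken[OF bihom_mult_mono4[of u' v' M G i k j l z], of "N * M"] bihom_nonneg[of u' v' M G]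
    by (auto intro: mult_right_mono)
next
  case (bihom_add u v N F N' F')
  then have "bihom (u + u') (v + v') (N * M + N' * M) (\<lambda>K. F K * G K + F' K * G K)"
    by (intro bihom.bihom_add)
  then show ?case by (simp add: distrib_right)
qed

lemma bihom_const: "bihom 0 0 (cmod z) (\<lambda>K. z)"
  using bihom_mono4[of 0 0 0 0 0 0 z "cmod z"] by (simp add: mono4_def)

lemma bihom_cmult: "bihom u v N F \<Longrightarrow> bihom u v (cmod z * N) (\<lambda>K. z * F K)"
  using bihom_mult[OF bihom_const] by force

lemma bihom_power:
  assumes "bihom u v N F"
  shows "bihom (n * u) (n * v) (N ^ n) (\<lambda>K. F K ^ n)"
proof (induction n)
  case 0
  then show ?case using bihom_const[of 1] by simp
next
  case (Suc n)
  then show ?case using bihom_mult[OF assms Suc] by simp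
qed

lemma bihom_sum:
  assumes "finite A" "\<And>i. i \<in> A \<Longrightarrow> bihom u v N (F i)"
  shows "bihom u v (real (card A) * N) (\<lambda>K. \<Sum>i\<in>A. F i K)"
  using assms
proof (induction A rule: finite_induct)
  case (insert i A)
  then have "bihom u v (N + real (card A) * N) (\<lambda>K. F i K + (\<Sum>i\<in>A. F i K))"
    by (intro bihom_add) auto
  then show ?case using insert by (simp add: algebra_simps)
qed (auto intro: bihom_zero)

section \<open>Derivatives of bihomogeneous polynomials\<close>

lemma cderiv_zero: "cderiv (\<lambda>K. 0) k (\<lambda>H. 0)"
  by (simp add: cderiv_def)

lemma cderiv_add:
  "cderiv F k F' \<Longrightarrow> cderiv G k G' \<Longrightarrow> cderiv (\<lambda>K. F K + G K) k (\<lambda>H. F' H + G' H)"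
  unfolding cderiv_def by (auto intro!: derivative_intros simp: distrib_left)

lemma cderiv_lin_comb:
  "(\<And>i. i \<in> A \<Longrightarrow> cderiv (F i) k (F' i)) \<Longrightarrow>
    cderiv (\<lambda>K. \<Sum>i\<in>A. c i * F i K) k (\<lambda>H. \<Sum>i\<in>A. c i * F' i H)"
  unfolding cderiv_def
  by (auto intro!: derivative_intros simp: sum_distrib_left mult_ac)

lemma cderiv_mono4:
  "cderiv (\<lambda>K. z * mono4 i j k l K) K (\<lambda>H.
    z * of_nat i * mono4 (i - 1) j k l K * H$1$1 + z * of_nat j * mono4 i (j - 1) k l K * H$1$2
    + z * of_nat k * mono4 i j (k - 1) l K * H$2$1 + z * of_nat l * mono4 i j k (l - 1) K * H$2$2)"
proof -
  have "((\<lambda>K::mat2. K$a$b) has_derivative (\<lambda>H. H$a$b)) (at K)" for a b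
    by (intro bounded_linear_imp_has_derivative bounded_linear_compose[OF bounded_linear_vec_nth]
        bounded_linear_vec_nth)
  note this[derivative_intros]
  show ?thesis
    unfolding cderiv_def mono4_def
    by (auto simp: mat2_mult mat2_mat algebra_simps intro!: derivative_eq_intros)
qed

lemma bihom_cderiv: "bihom u v N F \<Longrightarrow> \<exists>F'. cderiv F k F'"
proof (induction rule: bihom.induct)
  case (bihom_zero N u v)
  show ?case by (rule exI, rule cderiv_zero)
next
  case (bihom_mono4 u i k v j l z N)
  show ?case by (rule exI, rule cderiv_mono4)
next
  case (bihom_add u v N F M G)
  then obtain F' G' where "cderiv F k F'" "cderiv G k G'" by blast
  then show ?case by (intro exI) (rule cderiv_add)
qed

lemma dfield_zero: "dfield Z (\<lambda>K. 0) = (\<lambda>K. 0)"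
  using dfield_eq[OF cderiv_zero] by blast

lemma dfield_add:
  assumes "bihom u v N F" "bihom u v M G"
  shows "dfield Z (\<lambda>K. F K + G K) = (\<lambda>K. dfield Z F K + dfield Z G K)"
proof
  fix K
  obtain F' G' where "cderiv F K F'" "cderiv G K G'"
    using assms[THEN bihom_cderiv] by blast
  then show "dfield Z (\<lambda>K. F K + G K) K = dfield Z F K + dfield Z G K"
    by (simp add: dfield_eq dfield_eq[OF cderiv_add])
qed

lemma dfield_Y_mono4:
  "dfield sl2_Y (\<lambda>K. z * mono4 i j k l K) = (\<lambda>K. z * of_nat i * mono4 (i - 1) (j + 1) k l K
    + z * of_nat k * mono4 i j (k - 1) (l + 1) K)"
  unfolding fun_eq_iff dfield_eq[OF cderiv_mono4] by (simp add: mat2_mult sl2_Y_def mono4_def mult_ac)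

lemma dfield_X_mono4:
  "dfield sl2_X (\<lambda>K. z * mono4 i j k l K) = (\<lambda>K. z * of_nat j * mono4 (i + 1) (j - 1) k l K
    + z * of_nat l * mono4 i j (k + 1) (l - 1) K)"
  unfolding fun_eq_iff dfield_eq[OF cderiv_mono4] by (simp add: mat2_mult sl2_X_def mono4_def mult_ac)

text \<open>Differentiation lowers an exponent \<open>i\<close> to \<open>i - 1\<close>. For
  \<open>i = 0\<close> the truncated exponent gives the wrong bidegree, but then the coefficient
  vanishes.\<close>

lemma bihom_of_nat_mono4:
  assumes "i > 0 \<Longrightarrow> u = i' + k \<and> v = j + l" "cmod z \<le> N"
  shows "bihom u v (real i * N) (\<lambda>K. z * of_nat i * mono4 i' j k l K)"
proof (cases "i = 0")
  case False
  then show ?thesis using assms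
    by (intro bihom_mono4) (auto simp: norm_mult mult.commute intro: mult_left_mono)
qed (simp add: bihom_zero)

text \<open>The two terms of the Leibniz rule bring down exponents of the first column, which add up
  to \<open>u\<close>. For \<open>u = 0\<close> the new bound is 0, so the truncated
  \<open>u - 1\<close> does no harm.\<close>

lemma bihom_dfield_Y:
  "bihom u v N F \<Longrightarrow> bihom (u - 1) (v + 1) (real u * N) (dfield sl2_Y F)"
proof (induction rule: bihom.induct)
  case (bihom_zero N u v)
  then show ?case by (simp add: dfield_zero bihom.bihom_zero)
next
  case (bihom_mono4 u i k v j l z N)
  have "bihom (u - 1) (v + 1) (real i * N + real k * N)
      (\<lambda>K. z * of_nat i * mono4 (i - 1) (j + 1) k l K + z * of_nat k * mono4 i j (k - 1) (l + 1) K)"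
    using bihom_mono4 by (intro bihom_add bihom_of_nat_mono4) auto
  then show ?case using bihom_mono4 by (simp add: dfield_Y_mono4 distrib_right)
next
  case (bihom_add u v N F M G)
  then have "bihom (u - 1) (v + 1) (real u * N + real u * M) (\<lambda>K. dfield sl2_Y F K + dfield sl2_Y G K)"
    by (intro bihom.bihom_add)
  then show ?case using bihom_add by (simp add: dfield_add distrib_left)
qed

lemma bihom_dfield_X:
  "bihom u v N F \<Longrightarrow> bihom (u + 1) (v - 1) (real v * N) (dfield sl2_X F)"
proof (induction rule: bihom.induct)
  case (bihom_zero N u v)
  then show ?case by (simp add: dfield_zero bihom.bihom_zero)
next
  case (bihom_mono4 u i k v j l z N)
  have "bihom (u + 1) (v - 1) (real j * N + real l * N)
      (\<lambda>K. z * of_nat j * mono4 (i + 1) (j - 1) k l K + z * of_nat l * mono4 i j (k + 1) (l - 1) K)"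
    using bihom_mono4 by (intro bihom_add bihom_of_nat_mono4) auto
  then show ?case using bihom_mono4 by (simp add: dfield_X_mono4 distrib_right)
next
  case (bihom_add u v N F M G)
  then have "bihom (u + 1) (v - 1) (real v * N + real v * M) (\<lambda>K. dfield sl2_X F K + dfield sl2_X G K)"
    by (intro bihom.bihom_add)
  then show ?case using bihom_add by (simp add: dfield_add distrib_left)
qed

text \<open>The product of the degrees met in n derivatives is the falling factorial of
  \<open>u\<close>. Written as \<open>fact n\<close> times a binomial coefficient, it leaves a
  factorial for the star coefficient to cancel and a rest of at most \<open>2 ^ u\<close>; it is 0
  once n exceeds \<open>u\<close>.\<close>

lemma fact_choose_step:
  "real (u - n) * (fact n * real (u choose n) * N) = fact (Suc n) * real (u choose Suc n) * N"
proof -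
  have "Suc n * (u choose Suc n) = (u - n) * (u choose n)"
    by (simp only: binomial_absorption binomial_absorb_comp)
  then have "real (Suc n) * real (u choose Suc n) = real (u - n) * real (u choose n)"
    by (metis of_nat_mult)
  then have "fact n * N * (real (Suc n) * real (u choose Suc n))
      = fact n * N * (real (u - n) * real (u choose n))" by simp
  then show ?thesis by (simp only: fact_Suc of_nat_mult mult_ac)
qed

lemma bihom_dfield_Y_iter:
  assumes "bihom u v N F"
  shows "bihom (u - n) (v + n) (fact n * real (u choose n) * N) ((dfield sl2_Y ^^ n) F)"
proof (induction n)
  case (Suc n)
  show ?case
    using bihom_dfield_Y[OF Suc] unfolding fact_choose_step by (simp del: fact_Suc)
qed (use assms in simp)

lemma bihom_dfield_X_iter:
  assumes "bihom u v N F"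
  shows "bihom (u + n) (v - n) (fact n * real (v choose n) * N) ((dfield sl2_X ^^ n) F)"
proof (induction n)
  case (Suc n)
  show ?case
    using bihom_dfield_X[OF Suc] unfolding fact_choose_step by (simp del: fact_Suc)
qed (use assms in simp)

text \<open>By induction the n-th derivatives agree on SU(2). The next step is possible because
  \<open>dfield\<close> keeps the \<open>F i\<close> bihomogeneous and thus complex
  differentiable.\<close>

lemma left_field_iter:
  assumes F: "\<And>i. i \<in> A \<Longrightarrow> bihom (u i) (v i) (N i) (F i)"
    and f: "\<And>k. k \<in> SU2 \<Longrightarrow> f k = (\<Sum>i\<in>A. c i * F i k)"
    and Z: "Z = sl2_X \<or> Z = sl2_Y" and k: "k \<in> SU2"
  shows "(left_field Z ^^ n) f k = (\<Sum>i\<in>A. c i * (dfield Z ^^ n) (F i) k)"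
  using k
proof (induction n arbitrary: k)
  case (Suc n)
  have "\<exists>F'. cderiv ((dfield Z ^^ n) (F i)) k F'" if "i \<in> A" for i
    using Z bihom_dfield_X_iter[OF F[OF that], THEN bihom_cderiv]
      bihom_dfield_Y_iter[OF F[OF that], THEN bihom_cderiv] by blast
  then obtain F' where F': "\<And>i. i \<in> A \<Longrightarrow> cderiv ((dfield Z ^^ n) (F i)) k (F' i)"
    by metis
  have "(left_field Z ^^ Suc n) f k = (\<Sum>i\<in>A. c i * F' i (k ** Z))"
    using left_field_eq[OF Z Suc.prems Suc.IH cderiv_lin_comb[OF F']] by simp
  also have "\<dots> = (\<Sum>i\<in>A. c i * (dfield Z ^^ Suc n) (F i) k)"
    using dfield_eq[OF F'] by (intro sum.cong) auto
  finally show ?case .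
qed (simp add: f)

section \<open>Descent of functions on SU(2) to polynomials on the sphere\<close>

definition srep :: "real \<Rightarrow> nat \<Rightarrow> real \<Rightarrow> (mat2 \<Rightarrow> complex) \<Rightarrow> bool"
  where "srep lam u N F \<longleftrightarrow> (\<exists>G. polsum u N G \<and> (\<forall>k\<in>SU2. F k = G (psi lam k)))"

lemma srep_mono: "srep lam u N F \<Longrightarrow> u \<le> v \<Longrightarrow> N \<le> M \<Longrightarrow> srep lam v M F"
  unfolding srep_def by (blast intro: polsum_mono)

lemma srep_add: "srep lam u N F \<Longrightarrow> srep lam u M G \<Longrightarrow> srep lam u (N + M) (\<lambda>k. F k + G k)"
  unfolding srep_def by (elim exE conjE, rule exI, rule conjI, erule (1) polsum_add) auto

lemma srep_mult: "srep lam u N F \<Longrightarrow> srep lam v M G \<Longrightarrow> srep lam (u + v) (N * M) (\<lambda>k. F k * G k)"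
  unfolding srep_def by (elim exE conjE, rule exI, rule conjI, erule (1) polsum_mult) auto

lemma srep_const: "srep lam 0 (cmod z) (\<lambda>k. z)"
  unfolding srep_def using polsum_const by (intro exI[of _ "\<lambda>Z. z"]) auto

lemma srep_cmult: "srep lam u N F \<Longrightarrow> srep lam u (cmod z * N) (\<lambda>k. z * F k)"
  using srep_mult[OF srep_const] by force

lemma srep_cong: "srep lam u N F \<Longrightarrow> (\<And>k. k \<in> SU2 \<Longrightarrow> F k = G k) \<Longrightarrow> srep lam u N G"
  unfolding srep_def by metis

lemma srep_killing_form: "srep lam 1 1 (\<lambda>k. killing_form (sl2_basis i) (psi lam k))"
  unfolding srep_def using polsum_killing_form by blast

text \<open>The determinant relation \<open>ad - bc = 1\<close> makes \<open>ad\<close> and \<open>bc\<close> affine in \<open>ad + bc\<close>.\<close>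

lemma srep_entries:
  assumes "lam > 0"
  shows "srep lam 1 (1 + 1 / lam) (\<lambda>k. k$1$1 * k$2$2)"
    "srep lam 1 (1 + 1 / lam) (\<lambda>k. k$2$1 * k$1$2)"
    "srep lam 1 (1 + 1 / lam) (\<lambda>k. k$1$1 * k$1$2)"
    "srep lam 1 (1 + 1 / lam) (\<lambda>k. k$2$1 * k$2$2)"
proof -
  let ?K = "\<lambda>i k. killing_form (sl2_basis i) (psi lam k)"
  have const: "srep lam 1 (cmod z) (\<lambda>k. z)" for z
    by (rule srep_mono[OF srep_const]) auto
  have form: "srep lam 1 (cmod z) (\<lambda>k. z * ?K i k)" for z i
    using srep_cmult[OF srep_killing_form] by force
  have "srep lam 1 (cmod (1 / (2 * \<i> * lam)) + cmod (1 / 2)) (\<lambda>k. 1 / (2 * \<i> * lam) * ?K 1 k + 1 / 2)"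
    by (intro srep_add const form)
  then show "srep lam 1 (1 + 1 / lam) (\<lambda>k. k$1$1 * k$2$2)"
  proof (rule srep_cong[OF srep_mono])
    fix k assume k: "k \<in> SU2"
    show "1 / (2 * \<i> * lam) * ?K 1 k + 1 / 2 = k$1$1 * k$2$2"
      using assms SU2_entries(1)[OF k] by (simp add: killing_form_psi(1)[OF k] field_simps)
  qed (use assms in \<open>auto simp: norm_mult norm_divide field_simps\<close>)
  have "srep lam 1 (cmod (1 / (2 * \<i> * lam)) + cmod (- 1 / 2)) (\<lambda>k. 1 / (2 * \<i> * lam) * ?K 1 k + (- 1 / 2))"
    by (intro srep_add const form)
  then show "srep lam 1 (1 + 1 / lam) (\<lambda>k. k$2$1 * k$1$2)"
  proof (rule srep_cong[OF srep_mono])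
    fix k assume k: "k \<in> SU2"
    show "1 / (2 * \<i> * lam) * ?K 1 k + (- 1 / 2) = k$2$1 * k$1$2"
      using assms SU2_entries(1)[OF k] by (simp add: killing_form_psi(1)[OF k] field_simps)
  qed (use assms in \<open>auto simp: norm_mult norm_divide field_simps\<close>)
  show "srep lam 1 (1 + 1 / lam) (\<lambda>k. k$1$1 * k$1$2)"
  proof (rule srep_cong[OF srep_mono[OF form]])
    fix k assume k: "k \<in> SU2"
    show "\<i> / lam * ?K 3 k = k$1$1 * k$1$2"
      using assms by (simp add: killing_form_psi(3)[OF k] field_simps)
  qed (use assms in \<open>auto simp: norm_divide\<close>)
  show "srep lam 1 (1 + 1 / lam) (\<lambda>k. k$2$1 * k$2$2)"
  proof (rule srep_cong[OF srep_mono[OF form]])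
    fix k assume k: "k \<in> SU2"
    show "- \<i> / lam * ?K 2 k = k$2$1 * k$2$2"
      using assms by (simp add: killing_form_psi(2)[OF k] field_simps)
  qed (use assms in \<open>auto simp: norm_divide\<close>)
qed

text \<open>Equal degrees in the two columns express invariance under the diagonal torus, the
  stabilizer of \<mu>. They allow splitting off one entry from each column at a time, in one of four
  combinations, each covered by \<open>srep_entries\<close>.\<close>

lemma srep_mono4:
  assumes lam: "lam > 0" and "i + k = u" "j + l = u"
  shows "srep lam u ((1 + 1 / lam) ^ u) (mono4 i j k l)"
  using assms(2,3)
proof (induction u arbitrary: i j k l)
  case 0
  then show ?case using srep_const[of lam 1] by (simp add: mono4_def[abs_def])
next
  case (Suc u)
  have step: "srep lam (Suc u) ((1 + 1 / lam) ^ Suc u) (mono4 i j k l)"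
    if "srep lam 1 (1 + 1 / lam) G" "i' + k' = u" "j' + l' = u"
      "mono4 i j k l = (\<lambda>K. G K * mono4 i' j' k' l' K)" for G i' j' k' l'
    using srep_mult[OF that(1) Suc.IH[OF that(2,3)]] that(4) by simp
  consider i' j' where "i = Suc i'" "j = Suc j'" | i' l' where "i = Suc i'" "l = Suc l'"
    | k' j' where "k = Suc k'" "j = Suc j'" | k' l' where "k = Suc k'" "l = Suc l'"
    using Suc.prems by (metis add_is_0 nat.distinct(1) not0_implies_Suc)
  then show ?case
  proof cases
    case 1
    then show ?thesis using Suc.prems
      by (intro step[OF srep_entries(3)[OF lam], of i' k j' l]) (auto simp: mono4_def fun_eq_iff)
  next
    case 2
    then show ?thesis using Suc.prems
      by (intro step[OF srep_entries(1)[OF lam], of i' k j l']) (auto simp: mono4_def fun_eq_iff)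
  next
    case 3
    then show ?thesis using Suc.prems
      by (intro step[OF srep_entries(2)[OF lam], of i k' j' l]) (auto simp: mono4_def fun_eq_iff)
  next
    case 4
    then show ?thesis using Suc.prems
      by (intro step[OF srep_entries(4)[OF lam], of i k' j l']) (auto simp: mono4_def fun_eq_iff)
  qed
qed

lemma bihom_srep:
  assumes "lam > 0"
  shows "bihom u v N F \<Longrightarrow> u = v \<Longrightarrow> srep lam u ((1 + 1 / lam) ^ u * N) F"
proof (induction rule: bihom.induct)
  case (bihom_zero N u v)
  show ?case
    by (rule srep_mono[OF srep_const[of lam 0]]) (use bihom_zero assms in auto)
next
  case (bihom_mono4 u i k v j l z N)
  have "srep lam u (cmod z * (1 + 1 / lam) ^ u) (\<lambda>K. z * mono4 i j k l K)"
    by (intro srep_cmult srep_mono4 assms) (use bihom_mono4 in auto)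
  then show ?case
    using bihom_mono4 assms by (elim srep_mono) (auto simp: mult.commute[of N] mult.commute[of "cmod z"] intro!: mult_left_mono)
next
  case (bihom_add u v N F M G)
  then show ?case using srep_add by (simp add: distrib_left)
qed

section \<open>Estimates for the star product\<close>

text \<open>The pullback of a monomial along \<open>psi\<close>, continued from SU(2) to all
  matrices as a polynomial in the entries. Composition with \<open>psi\<close> itself would involve
  the matrix inverse.\<close>

definition sphere_monomial :: "real \<Rightarrow> (3 \<Rightarrow>\<^sub>0 nat) \<Rightarrow> mat2 \<Rightarrow> complex"
  where "sphere_monomial lam I K =
    (\<i> * lam * (K$1$1 * K$2$2 + K$1$2 * K$2$1)) ^ Poly_Mapping.lookup I 1
    * (\<i> * lam * (K$2$1 * K$2$2)) ^ Poly_Mapping.lookup I 2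
    * (- (\<i> * lam * (K$1$1 * K$1$2))) ^ Poly_Mapping.lookup I 3"

lemma monomial_fun_psi:
  assumes "k \<in> SU2"
  shows "monomial_fun I (psi lam k) = sphere_monomial lam I k"
proof -
  have "monomial_fun I Z = killing_form (sl2_basis 1) Z ^ Poly_Mapping.lookup I 1
      * killing_form (sl2_basis 2) Z ^ Poly_Mapping.lookup I 2
      * killing_form (sl2_basis 3) Z ^ Poly_Mapping.lookup I 3" for Z
    unfolding monomial_fun_def UNIV_3 by simp
  from this[of "psi lam k"] show ?thesis
    unfolding sphere_monomial_def killing_form_psi[OF assms] .
qed

text \<open>The factor 2 comes from the generator of H, whose pullback has two terms with
  coefficients of modulus \<open>lam\<close>; the other two generators are given the same
  bound.\<close>

lemma bihom_sphere_monomial: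
  assumes "lam > 0"
  shows "bihom (multi_deg I) (multi_deg I) ((2 * lam) ^ multi_deg I) (sphere_monomial lam I)"
proof -
  have h: "bihom 1 1 (2 * lam) (\<lambda>K. \<i> * lam * (K$1$1 * K$2$2 + K$1$2 * K$2$1))"
    using bihom_add[OF bihom_mono4[of 1 1 0 1 0 1 "\<i> * lam" lam] bihom_mono4[of 1 0 1 1 1 0 "\<i> * lam" lam]] assms
    by (simp add: mono4_def norm_mult algebra_simps)
  have x: "bihom 1 1 (2 * lam) (\<lambda>K. \<i> * lam * (K$2$1 * K$2$2))"
    using bihom_mono4[of 1 0 1 1 0 1 "\<i> * lam" "2 * lam"] assms
    by (simp add: mono4_def norm_mult algebra_simps)
  have y: "bihom 1 1 (2 * lam) (\<lambda>K. - (\<i> * lam * (K$1$1 * K$1$2)))"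
    using bihom_mono4[of 1 1 0 1 1 0 "- (\<i> * lam)" "2 * lam"] assms
    by (simp add: mono4_def norm_mult algebra_simps)
  show ?thesis
    using bihom_mult[OF bihom_mult[OF bihom_power[OF h, of "Poly_Mapping.lookup I 1"]
        bihom_power[OF x, of "Poly_Mapping.lookup I 2"]] bihom_power[OF y, of "Poly_Mapping.lookup I 3"]]
    by (simp add: sphere_monomial_def[abs_def] multi_deg_def sum_3 power_add)
qed

definition star_coeff :: "real \<Rightarrow> complex \<Rightarrow> nat \<Rightarrow> complex"
  where "star_coeff lam hbar n =
    (-1) ^ n * hbar ^ n / (fact n * (\<Prod>j<n. complex_of_real lam - of_nat j * hbar))"

text \<open>For large \<open>j\<close> the distance from \<open>s\<close> to \<open>j\<close> is at
  least half of \<open>j + 1\<close>; the finitely many remaining distances are positive.\<close>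

lemma dist_Nats_lower_bound:
  fixes s :: complex
  assumes "s \<notin> \<nat>"
  obtains D :: real where "D \<ge> 1" "\<And>j::nat. real (Suc j) \<le> D * cmod (s - of_nat j)"
proof -
  obtain M :: nat where M: "2 * cmod s + 1 \<le> real M"
    using real_arch_simple by blast
  \<comment> \<open>The 2 handles all \<open>j \<ge> M\<close>, and each summand handles its own
    \<open>j < M\<close>.\<close>
  define D where "D = 2 + (\<Sum>j<M. real (Suc j) / cmod (s - of_nat j))"
  have pos: "cmod (s - of_nat j) > 0" for j :: nat
    using assms by (auto simp: Nats_def)
  have nonneg: "(\<Sum>j<M. real (Suc j) / cmod (s - of_nat j)) \<ge> 0"
    by (intro sum_nonneg) auto
  have "real (Suc j) \<le> D * cmod (s - of_nat j)" for j
  proof (cases "j < M")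
    case True
    have "real (Suc j) / cmod (s - of_nat j) \<le> (\<Sum>j<M. real (Suc j) / cmod (s - of_nat j))"
      using True by (intro member_le_sum) auto
    also have "\<dots> \<le> D" by (simp add: D_def)
    finally show ?thesis using pos[of j] by (simp add: field_simps)
  next
    case False
    have "real j - cmod s \<le> cmod (s - of_nat j)"
      using norm_triangle_ineq2[of "of_nat j" s] by (simp add: norm_minus_commute)
    moreover have "2 * cmod s + 1 \<le> real j" using M False by simp
    ultimately have "real (Suc j) \<le> 2 * cmod (s - of_nat j)" by simp
    also have "\<dots> \<le> D * cmod (s - of_nat j)"
      using nonneg by (intro mult_right_mono) (auto simp: D_def)
    finally show ?thesis .
  qed
  moreover have "D \<ge> 1" using nonneg by (simp add: D_def)
  ultimately show ?thesis using that by blast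
qed

text \<open>Taking \<open>hbar\<close> out of every factor of the denominator cancels
  \<open>hbar ^ n\<close> and leaves the product of the \<open>s - j\<close> with
  \<open>s = lam / hbar\<close>, of modulus at least \<open>fact n / D ^ n\<close>. The second
  factorial is the explicit one in the coefficient.\<close>

lemma star_coeff_bound:
  assumes "hbar \<noteq> 0" "complex_of_real lam / hbar \<notin> \<nat>"
  obtains D where "D \<ge> 1" "\<And>n. cmod (star_coeff lam hbar n) * (fact n * fact n) \<le> D ^ n"
proof -
  define s where "s = complex_of_real lam / hbar"
  obtain D where D: "D \<ge> 1" "\<And>j::nat. real (Suc j) \<le> D * cmod (s - of_nat j)"
    using dist_Nats_lower_bound assms unfolding s_def by metis
  have pos: "cmod (s - of_nat j) > 0" for j :: nat
    using assms by (auto simp: Nats_def s_def)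
  have "cmod (star_coeff lam hbar n) * (fact n * fact n) \<le> D ^ n" for n
  proof -
    have "(\<Prod>j<n. complex_of_real lam - of_nat j * hbar) = (\<Prod>j<n. hbar * (s - of_nat j))"
      using assms(1) by (intro prod.cong) (auto simp: s_def field_simps)
    also have "\<dots> = hbar ^ n * (\<Prod>j<n. s - of_nat j)"
      by (simp add: prod.distrib)
    finally have c: "cmod (star_coeff lam hbar n) = 1 / (fact n * (\<Prod>j<n. cmod (s - of_nat j)))"
      using assms(1) by (simp add: star_coeff_def norm_mult norm_divide norm_power prod_norm)
    have "(fact n :: real) = (\<Prod>j<n. real (Suc j))"
      by (induction n) (auto simp: mult.commute)
    also have "\<dots> \<le> (\<Prod>j<n. D * cmod (s - of_nat j))"
      using D by (intro prod_mono) auto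
    also have "\<dots> = D ^ n * (\<Prod>j<n. cmod (s - of_nat j))"
      by (simp add: prod.distrib)
    finally have "fact n \<le> D ^ n * (\<Prod>j<n. cmod (s - of_nat j))" .
    moreover have "(\<Prod>j<n. cmod (s - of_nat j)) > 0"
      using pos by (intro prod_pos) auto
    ultimately show ?thesis by (simp add: c field_simps)
  qed
  then show ?thesis using that D by blast
qed

definition star_summand :: "real \<Rightarrow> complex \<Rightarrow> (3 \<Rightarrow>\<^sub>0 nat) \<Rightarrow> (3 \<Rightarrow>\<^sub>0 nat) \<Rightarrow> nat \<Rightarrow> mat2 \<Rightarrow> complex"
  where "star_summand lam hbar I J n k = star_coeff lam hbar n *
    ((dfield sl2_Y ^^ n) (sphere_monomial lam I) k * (dfield sl2_X ^^ n) (sphere_monomial lam J) k)"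

text \<open>For \<open>lam > 0\<close> the summands vanish as soon as \<open>n\<close> exceeds one
  of the two degrees, so this finite sum is the whole series.\<close>

definition star_monomial :: "real \<Rightarrow> complex \<Rightarrow> (3 \<Rightarrow>\<^sub>0 nat) \<Rightarrow> (3 \<Rightarrow>\<^sub>0 nat) \<Rightarrow> mat2 \<Rightarrow> complex"
  where "star_monomial lam hbar I J k = (\<Sum>n\<le>multi_deg I + multi_deg J. star_summand lam hbar I J n k)"

lemma star_summand_eq_0:
  assumes "lam > 0" "multi_deg I < n \<or> multi_deg J < n"
  shows "star_summand lam hbar I J n = (\<lambda>k. 0)"
  using assms(2)
proof
  assume "multi_deg I < n"
  then have "(dfield sl2_Y ^^ n) (sphere_monomial lam I) = (\<lambda>k. 0)"
    using bihom_bound_0[OF bihom_dfield_Y_iter[OF bihom_sphere_monomial[OF assms(1), of I], of n]] by simp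
  then show ?thesis by (simp add: star_summand_def fun_eq_iff)
next
  assume "multi_deg J < n"
  then have "(dfield sl2_X ^^ n) (sphere_monomial lam J) = (\<lambda>k. 0)"
    using bihom_bound_0[OF bihom_dfield_X_iter[OF bihom_sphere_monomial[OF assms(1), of J], of n]] by simp
  then show ?thesis by (simp add: star_summand_def fun_eq_iff)
qed

lemma star_summand_sums:
  assumes "lam > 0"
  shows "(\<lambda>n. star_summand lam hbar I J n k) sums star_monomial lam hbar I J k"
  unfolding star_monomial_def
  by (rule sums_finite) (use star_summand_eq_0[OF assms] in auto)

text \<open>The constant collects one factor for each source of exponential growth: \<open>A\<close>
  for the descent to the sphere, 2 for the number of summands, \<open>D\<close> for the star
  coefficient, 2 for the binomial coefficients and \<open>L\<close> for the generators.\<close>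

lemma srep_star_monomial:
  assumes lam: "lam > 0" and "hbar \<noteq> 0" "complex_of_real lam / hbar \<notin> \<nat>"
  obtains G where "G \<ge> 1"
    "\<And>I J. srep lam (multi_deg I + multi_deg J) (G ^ (multi_deg I + multi_deg J)) (star_monomial lam hbar I J)"
proof -
  obtain D where D: "D \<ge> 1" "\<And>n. cmod (star_coeff lam hbar n) * (fact n * fact n) \<le> D ^ n"
    using star_coeff_bound assms by blast
  define L where "L = 1 + 2 * lam"
  have L: "L \<ge> 1" "2 * lam \<le> L" using lam by (auto simp: L_def)
  define A where "A = 1 + 1 / lam"
  have A: "A \<ge> 1" using lam by (simp add: A_def)
  have "srep lam (m + m') ((A * (2 * (D * 2 * L))) ^ (m + m')) (star_monomial lam hbar I J)"
    if m: "m = multi_deg I" "m' = multi_deg J" for I J m m'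
  proof -
    have summand: "bihom (m + m') (m + m') ((D * 2 * L) ^ (m + m')) (star_summand lam hbar I J n)"
      if "n \<le> m + m'" for n
    proof (cases "n \<le> m \<and> n \<le> m'")
      case True
      let ?N = "cmod (star_coeff lam hbar n) *
        (fact n * real (m choose n) * (2 * lam) ^ m * (fact n * real (m' choose n) * (2 * lam) ^ m'))"
      \<comment> \<open>Y moves \<open>n\<close> factors from the first column to the second and X
        moves \<open>n\<close> back, so the bidegree of the product is balanced; as \<open>n\<close>
        is at most \<open>m\<close> and \<open>m'\<close>, no subtraction is truncated.\<close>
      have "bihom (m - n + (m' + n)) (m + n + (m' - n)) ?N (star_summand lam hbar I J n)"
        unfolding star_summand_def[abs_def] m
        by (intro bihom_cmult bihom_mult bihom_dfield_X_iter bihom_dfield_Y_iter bihom_sphere_monomial lam)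
      moreover have "?N \<le> (D * 2 * L) ^ (m + m')"
      proof -
        have "real (m choose n) \<le> 2 ^ m" "real (m' choose n) \<le> 2 ^ m'"
          by (metis binomial_le_pow2 of_nat_le_iff of_nat_numeral of_nat_power)+
        then have ch: "real (m choose n) * real (m' choose n) \<le> 2 ^ m * 2 ^ m'"
          by (intro mult_mono) auto
        have lm: "(2 * lam) ^ m * (2 * lam) ^ m' \<le> L ^ m * L ^ m'"
          using lam L by (intro mult_mono power_mono) auto
        have "?N = (cmod (star_coeff lam hbar n) * (fact n * fact n))
            * (real (m choose n) * real (m' choose n)) * ((2 * lam) ^ m * (2 * lam) ^ m')"
          by (simp only: mult_ac)
        also have "\<dots> \<le> D ^ n * (2 ^ m * 2 ^ m') * (L ^ m * L ^ m')"
          using D lam by (intro mult_mono ch lm) auto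
        also have "\<dots> \<le> D ^ (m + m') * (2 ^ m * 2 ^ m') * (L ^ m * L ^ m')"
          using D L that by (intro mult_right_mono power_increasing) auto
        also have "\<dots> = (D * 2 * L) ^ (m + m')"
          by (simp only: power_add power_mult_distrib mult_ac)
        finally show ?thesis .
      qed
      ultimately show ?thesis using True by (auto intro: bihom_weaken)
    next
      case False
      then have "star_summand lam hbar I J n = (\<lambda>k. 0)"
        by (intro star_summand_eq_0 lam) (auto simp: m)
      then show ?thesis using D L by (auto intro: bihom_zero)
    qed
    \<comment> \<open>The number of summands, \<open>m + m' + 1\<close>, is at most
      \<open>2 ^ (m + m')\<close>.\<close>
    have "bihom (m + m') (m + m') (real (card {..m + m'}) * (D * 2 * L) ^ (m + m')) (star_monomial lam hbar I J)"
      unfolding star_monomial_def[abs_def] m[symmetric] by (intro bihom_sum summand) auto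
    moreover have "real (card {..m + m'}) \<le> 2 ^ (m + m')"
      using less_exp[of "m + m'"] by (metis Suc_leI card_atMost of_nat_le_iff of_nat_numeral of_nat_power)
    ultimately have "bihom (m + m') (m + m') (2 ^ (m + m') * (D * 2 * L) ^ (m + m')) (star_monomial lam hbar I J)"
      using D L by (elim bihom_weaken mult_right_mono) auto
    from bihom_srep[OF lam this refl] show ?thesis
      by (simp only: A_def power_mult_distrib)
  qed
  moreover have "A * (2 * (D * 2 * L)) \<ge> 1"
  proof -
    have "1 * 1 \<le> D * L" using D L by (intro mult_mono) auto
    then have "1 * 1 \<le> A * (2 * (D * 2 * L))" using A by (intro mult_mono) auto
    then show ?thesis by simp
  qed
  ultimately show ?thesis using that by blast
qed

section \<open>The star product on representatives and its norm estimate\<close>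

definition star_rep :: "real \<Rightarrow> complex \<Rightarrow> 3 sym_alg \<Rightarrow> 3 sym_alg \<Rightarrow> mat2 \<Rightarrow> complex"
  where "star_rep lam hbar P Q k = lin_ext (\<lambda>I. lin_ext (\<lambda>J. star_monomial lam hbar I J k) Q) P"

text \<open>The usual telescoping of a bilinear map, by which the norm estimate yields
  continuity.\<close>

lemma star_rep_diff:
  "star_rep lam hbar P' Q' k - star_rep lam hbar P Q k
    = star_rep lam hbar (P' - P) Q' k + star_rep lam hbar P (Q' - Q) k"
  by (simp add: star_rep_def lin_ext_diff lin_ext_diff_weight)

lemma fact_add_le: "fact (m + n) \<le> (2 ^ (m + n) * fact m * fact n :: real)"
proof -
  have "(fact (m + n) :: real) = fact m * fact n * real (m + n choose m)"
    by (metis add_diff_cancel_left' binomial_fact_lemma le_add1 of_nat_fact of_nat_mult)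
  also have "\<dots> \<le> fact m * fact n * 2 ^ (m + n)"
    by (intro mult_left_mono) (metis binomial_le_pow2 of_nat_le_iff of_nat_numeral of_nat_power, simp)
  finally show ?thesis by (simp add: mult_ac)
qed

text \<open>By bilinearity only pairs of monomials matter, and both sides are sums over such pairs.
  The constant is fixed before \<open>P\<close> and \<open>Q\<close>, so the estimate is uniform in
  them.\<close>

lemma star_rep_bound:
  assumes "lam > 0" "hbar \<noteq> 0" "complex_of_real lam / hbar \<notin> \<nat>" and R: "R \<ge> 0" and C: "C \<ge> 1"
  obtains C' where "C' \<ge> 1" "\<And>P Q. \<exists>r. (\<forall>k\<in>SU2. pol_eval r (psi lam k) = star_rep lam hbar P Q k)
    \<and> TR_norm R C r \<le> TR_norm R C' P * TR_norm R C' Q"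
proof -
  obtain G where G: "G \<ge> 1" "\<And>I J. srep lam (multi_deg I + multi_deg J)
      (G ^ (multi_deg I + multi_deg J)) (star_monomial lam hbar I J)"
    using srep_star_monomial assms by blast
  let ?d = "\<lambda>I J. multi_deg I + multi_deg J"
  define represents where "represents = (\<lambda>I J z r.
    (\<forall>k\<in>SU2. pol_eval r (psi lam k) = z * star_monomial lam hbar I J k) \<and>
    TR_norm R C r \<le> fact (?d I J) powr R * C ^ ?d I J * (cmod z * G ^ ?d I J))"
  \<comment> \<open>The scalar \<open>z\<close> is part of the choice, so that afterwards
    representatives only have to be added.\<close>
  define \<rho> where "\<rho> = (\<lambda>I J z. SOME r. represents I J z r)"
  have "represents I J z (\<rho> I J z)" for I J z
  proof -
    obtain F where F: "polsum (?d I J) (cmod z * G ^ ?d I J) F"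
      "\<And>k. k \<in> SU2 \<Longrightarrow> z * star_monomial lam hbar I J k = F (psi lam k)"
      using srep_cmult[OF G(2)[of I J], of z] unfolding srep_def by blast
    then have "\<exists>r. represents I J z r"
      unfolding represents_def using polsum_repr[OF F(1) R C] by auto
    then show ?thesis unfolding \<rho>_def by (rule someI_ex)
  qed
  then have
    \<rho>: "\<And>I J z k. k \<in> SU2 \<Longrightarrow> pol_eval (\<rho> I J z) (psi lam k) = z * star_monomial lam hbar I J k"
      "\<And>I J z. TR_norm R C (\<rho> I J z) \<le> fact (?d I J) powr R * C ^ ?d I J * (cmod z * G ^ ?d I J)"
    unfolding represents_def by blast+
  \<comment> \<open>Per degree, \<open>2 powr R\<close> pays for splitting the factorial of a sum of
    degrees, \<open>C\<close> is the given weight and \<open>G\<close> the growth of the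
    1-norm.\<close>
  define C' where "C' = 2 powr R * C * G"
  have "1 * 1 * 1 \<le> C'"
    unfolding C'_def using R C G by (intro mult_mono) (auto simp: ge_one_powr_ge_zero)
  then have C': "C' \<ge> 1" by simp
  have "\<exists>r. (\<forall>k\<in>SU2. pol_eval r (psi lam k) = star_rep lam hbar P Q k)
    \<and> TR_norm R C r \<le> TR_norm R C' P * TR_norm R C' Q" for P Q
  proof -
    let ?P = "Poly_Mapping.lookup P" and ?Q = "Poly_Mapping.lookup Q"
    let ?w = "\<lambda>I. fact (multi_deg I) powr R * C' ^ multi_deg I"
    define r where "r = (\<Sum>I\<in>Poly_Mapping.keys P. \<Sum>J\<in>Poly_Mapping.keys Q. \<rho> I J (?P I * ?Q J))"
    have sum: "pol_eval (\<Sum>i\<in>A. f i) Z = (\<Sum>i\<in>A. pol_eval (f i) Z)" for A :: "'i set" and f Z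
      by (induction A rule: infinite_finite_induct)
        (simp_all add: pol_eval_lin_ext lin_ext_add, simp_all add: lin_ext_def)
    have "pol_eval r (psi lam k) = star_rep lam hbar P Q k" if "k \<in> SU2" for k
      by (simp add: r_def sum \<rho>(1)[OF that] star_rep_def lin_ext_def sum_distrib_left mult_ac)
    moreover have "TR_norm R C r \<le> TR_norm R C' P * TR_norm R C' Q"
    proof -
      have \<rho>': "TR_norm R C (\<rho> I J (?P I * ?Q J)) \<le> (?w I * cmod (?P I)) * (?w J * cmod (?Q J))" for I J
      proof -
        have "fact (?d I J) powr R
            \<le> (2 ^ ?d I J * fact (multi_deg I) * fact (multi_deg J)) powr R"
          using R by (intro powr_mono2 fact_add_le) auto
        also have "\<dots> = (2 powr R) ^ ?d I J * (fact (multi_deg I) powr R * fact (multi_deg J) powr R)"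
        proof -
          have "(2 ^ n :: real) powr R = (2 powr R) ^ n" for n
            by (induction n) (simp_all add: powr_mult)
          then show ?thesis by (simp add: powr_mult)
        qed
        finally have "fact (?d I J) powr R * (C ^ ?d I J * (cmod (?P I * ?Q J) * G ^ ?d I J)) \<le>
            (2 powr R) ^ ?d I J * (fact (multi_deg I) powr R * fact (multi_deg J) powr R)
            * (C ^ ?d I J * (cmod (?P I * ?Q J) * G ^ ?d I J))"
          using C G by (intro mult_right_mono) auto
        also have "\<dots> = (?w I * cmod (?P I)) * (?w J * cmod (?Q J))"
          by (simp add: C'_def power_add power_mult_distrib norm_mult mult_ac)
        finally show ?thesis using \<rho>(2)[of I J "?P I * ?Q J"] by (simp only: mult.assoc)
      qed
      have "TR_norm R C r \<le> (\<Sum>I\<in>Poly_Mapping.keys P. \<Sum>J\<in>Poly_Mapping.keys Q. TR_norm R C (\<rho> I J (?P I * ?Q J)))"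
        unfolding r_def using C
        by (intro order_trans[OF TR_norm_sum] sum_mono TR_norm_sum) auto
      also have "\<dots> \<le> (\<Sum>I\<in>Poly_Mapping.keys P. \<Sum>J\<in>Poly_Mapping.keys Q.
          (?w I * cmod (?P I)) * (?w J * cmod (?Q J)))"
        by (intro sum_mono \<rho>')
      also have "\<dots> = TR_norm R C' P * TR_norm R C' Q"
        by (simp add: TR_norm_def sum_product)
      finally show ?thesis .
    qed
    ultimately show ?thesis by blast
  qed
  then show ?thesis using that C' by blast
qed

section \<open>Polynomials on the sphere and the quotient topology\<close>

text \<open>\<open>polynomial_function_mult\<close> multiplies by real-valued functions, so
  \<open>f\<close> is split into its real and imaginary parts.\<close>

lemma polynomial_function_complex_mult:
  fixes f g :: "'a::real_normed_vector \<Rightarrow> complex"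
  assumes f: "polynomial_function f" and g: "polynomial_function g"
  shows "polynomial_function (\<lambda>x. f x * g x)"
proof -
  have comp: "polynomial_function (\<lambda>x. h (p x))"
    if "polynomial_function p" "bounded_linear h"
    for p :: "'a \<Rightarrow> complex" and h :: "complex \<Rightarrow> 'b::real_normed_vector"
    using that(1) bounded_linear_compose[OF _ that(2)] unfolding polynomial_function_def o_def
    by blast
  have "polynomial_function (\<lambda>x. Re (f x) *\<^sub>R g x + Im (f x) *\<^sub>R (\<i> * g x))"
    using comp[OF f bounded_linear_Re] comp[OF f bounded_linear_Im] g
      comp[OF g bounded_linear_mult_right[of \<i>]]
    by (intro polynomial_function_add polynomial_function_mult)
  moreover have "(\<lambda>x. Re (f x) *\<^sub>R g x + Im (f x) *\<^sub>R (\<i> * g x)) = (\<lambda>x. f x * g x)"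
    by (auto simp: fun_eq_iff complex_eq_iff)
  ultimately show ?thesis by simp
qed

lemma polynomial_function_complex_power:
  fixes f :: "'a::real_normed_vector \<Rightarrow> complex"
  shows "polynomial_function f \<Longrightarrow> polynomial_function (\<lambda>x. f x ^ n)"
  by (induction n) (auto intro: polynomial_function_complex_mult)

lemma polynomial_function_complex_prod:
  fixes f :: "'i \<Rightarrow> 'a::real_normed_vector \<Rightarrow> complex"
  assumes "\<And>i. i \<in> A \<Longrightarrow> polynomial_function (f i)"
  shows "polynomial_function (\<lambda>x. \<Prod>i\<in>A. f i x)"
  using assms by (induction A rule: infinite_finite_induct)
    (auto intro: polynomial_function_complex_mult)

lemma polynomial_function_entry: "polynomial_function (\<lambda>Z::mat2. Z$i$j)"
  by (intro polynomial_function_bounded_linear bounded_linear_compose[OF bounded_linear_vec_nth]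
      bounded_linear_vec_nth)

lemma polynomial_function_killing_form: "polynomial_function (killing_form (sl2_basis i))"
proof -
  have "polynomial_function (killing_form (sl2_basis 1))"
    "polynomial_function (killing_form (sl2_basis 2))"
    "polynomial_function (killing_form (sl2_basis 3))"
    unfolding killing_form_entries[abs_def]
    by (intro polynomial_function_complex_mult polynomial_function_const polynomial_function_diff
        polynomial_function_entry)+
  with exhaust_3[of i] show ?thesis by (elim disjE) simp_all
qed

lemma pol_restrict_in_Pol_sphere: "pol_restrict lam p \<in> Pol_sphere lam"
proof -
  have "polynomial_function (\<lambda>Z. pol_eval p Z)"
    unfolding pol_eval_def
    by (intro polynomial_function_sum polynomial_function_complex_mult polynomial_function_const
        polynomial_function_complex_prod polynomial_function_complex_power
        polynomial_function_killing_form finite_keys)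
  then show ?thesis unfolding pol_restrict_def Pol_sphere_def by blast
qed

lemma psi_skew:
  assumes "k \<in> SU2"
  shows "psi lam k $2$2 = - (psi lam k $1$1)" "psi lam k $2$1 = - cnj (psi lam k $1$2)"
    "Re (psi lam k $1$1) = 0"
  using SU2_entries(2,3)[OF assms] by (simp_all add: psi_entries[OF assms])

text \<open>On the sphere a real linear functional only sees traceless skew-Hermitian matrices, so
  it is determined by its values on the real basis \<open>E1\<close>, \<open>E2\<close>,
  \<open>E3\<close> and is a combination of the three generators. Sums and products follow.\<close>

lemma srep_real_polynomial_function:
  assumes "real_polynomial_function f"
  shows "\<exists>u N. srep lam u N (\<lambda>k. complex_of_real (f (psi lam k)))"
  using assms
proof induction
  case (linear f)
  then interpret bounded_linear f .
  define E1 :: mat2 where "E1 = vector [vector [\<i>, 0], vector [0, - \<i>]]"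
  define E2 :: mat2 where "E2 = vector [vector [0, 1], vector [- 1, 0]]"
  define E3 :: mat2 where "E3 = vector [vector [0, \<i>], vector [\<i>, 0]]"
  let ?K = "\<lambda>i k. killing_form (sl2_basis i) (psi lam k)"
  have form: "srep lam 1 (cmod z) (\<lambda>k. z * ?K i k)" for z i
    using srep_cmult[OF srep_killing_form] by force
  \<comment> \<open>These constants solve for the real coordinates: the H-generator is 8\<i> times
    the imaginary part of the entry (1,1), and those of X and Y are -4 times the conjugate of the
    entry (1,2) and 4 times that entry.\<close>
  let ?c1 = "Complex 0 (- f E1 / 8)" and ?c2 = "Complex (- f E2 / 8) (- f E3 / 8)"
    and ?c3 = "Complex (f E2 / 8) (- f E3 / 8)"
  have "srep lam 1 (cmod ?c1 + cmod ?c2 + cmod ?c3) (\<lambda>k. ?c1 * ?K 1 k + ?c2 * ?K 2 k + ?c3 * ?K 3 k)"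
    by (intro srep_add form)
  moreover have "?c1 * ?K 1 k + ?c2 * ?K 2 k + ?c3 * ?K 3 k = complex_of_real (f (psi lam k))"
    if k: "k \<in> SU2" for k
  proof -
    let ?Z = "psi lam k"
    have Z: "?Z = Im (?Z$1$1) *\<^sub>R E1 + Re (?Z$1$2) *\<^sub>R E2 + Im (?Z$1$2) *\<^sub>R E3"
      using psi_skew[OF k, of lam]
      by (simp add: mat2_eq_iff E1_def E2_def E3_def complex_eq_iff)
    have f: "f ?Z = Im (?Z$1$1) * f E1 + Re (?Z$1$2) * f E2 + Im (?Z$1$2) * f E3"
      by (subst Z) (simp add: add scaleR)
    show ?thesis
      unfolding f killing_form_entries psi_skew(1,2)[OF k] using psi_skew(3)[OF k, of lam]
      by (simp add: complex_eq_iff field_simps)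
  qed
  ultimately show ?case by (meson srep_cong)
next
  case (const c)
  show ?case using srep_const by blast
next
  case (add f g)
  then obtain u N v M where "srep lam u N (\<lambda>k. complex_of_real (f (psi lam k)))"
    "srep lam v M (\<lambda>k. complex_of_real (g (psi lam k)))" by blast
  then have "srep lam (max u v) (N + M) (\<lambda>k. of_real (f (psi lam k)) + of_real (g (psi lam k)))"
    by (intro srep_add) (auto elim: srep_mono)
  then show ?case by auto
next
  case (mult f g)
  then obtain u N v M where "srep lam u N (\<lambda>k. complex_of_real (f (psi lam k)))"
    "srep lam v M (\<lambda>k. complex_of_real (g (psi lam k)))" by blast
  from srep_mult[OF this] show ?case by auto
qed

text \<open>Surjectivity of restriction from polynomials in the generators, obtained by treating
  real and imaginary parts separately; it gives every function on the sphere a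
  representative.\<close>

lemma Pol_sphere_eq: "Pol_sphere lam = range (pol_restrict lam)"
proof (intro equalityI subsetI)
  fix p assume "p \<in> Pol_sphere lam"
  then obtain f where f: "p = restrict f (sphere2 lam)" "polynomial_function f"
    by (auto simp: Pol_sphere_def)
  have "real_polynomial_function (\<lambda>Z. Re (f Z))" "real_polynomial_function (\<lambda>Z. Im (f Z))"
    using f(2) bounded_linear_Re bounded_linear_Im unfolding polynomial_function_def o_def by blast+
  then obtain u N v M where "srep lam u N (\<lambda>k. complex_of_real (Re (f (psi lam k))))"
    "srep lam v M (\<lambda>k. complex_of_real (Im (f (psi lam k))))"
    using srep_real_polynomial_function by meson
  then have "srep lam (max u v) (N + cmod \<i> * M)
      (\<lambda>k. complex_of_real (Re (f (psi lam k))) + \<i> * complex_of_real (Im (f (psi lam k))))"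
    by (intro srep_add srep_cmult) (auto elim: srep_mono)
  then obtain G where G: "polsum (max u v) (N + cmod \<i> * M) G"
    "\<And>k. k \<in> SU2 \<Longrightarrow> f (psi lam k) = G (psi lam k)"
    unfolding srep_def complex_eq[symmetric] by blast
  obtain r where "pol_eval r = G"
    using polsum_repr[OF G(1), of 0 1] by auto
  then have "p = pol_restrict lam r"
    using f(1) G(2) by (auto simp: pol_restrict_def sphere2_def restrict_def fun_eq_iff)
  then show "p \<in> range (pol_restrict lam)" by blast
qed (use pol_restrict_in_Pol_sphere in auto)

lemma pol_restrict_psi: "k \<in> SU2 \<Longrightarrow> pol_restrict lam p (psi lam k) = pol_eval p (psi lam k)"
  by (simp add: pol_restrict_def sphere2_def)

lemma pol_restrict_eq_iff:
  "pol_restrict lam p = pol_restrict lam q \<longleftrightarrow>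
    (\<forall>k\<in>SU2. pol_eval p (psi lam k) = pol_eval q (psi lam k))"
  by (auto simp: pol_restrict_def sphere2_def restrict_def fun_eq_iff)

section \<open>The star product computed from representatives\<close>

lemma star_series_sums:
  assumes lam: "lam > 0" and k: "k \<in> SU2"
  shows "(\<lambda>n. star_coeff lam hbar n
      * (left_field sl2_Y ^^ n) (pol_restrict lam P \<circ> psi lam) k
      * (left_field sl2_X ^^ n) (pol_restrict lam Q \<circ> psi lam) k) sums star_rep lam hbar P Q k"
proof -
  have iter: "(left_field Z ^^ n) (pol_restrict lam p \<circ> psi lam) k
      = (\<Sum>I\<in>Poly_Mapping.keys p. Poly_Mapping.lookup p I * (dfield Z ^^ n) (sphere_monomial lam I) k)"
    if "Z = sl2_X \<or> Z = sl2_Y" for Z n p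
    by (rule left_field_iter[OF bihom_sphere_monomial[OF lam] _ that k])
      (simp add: pol_restrict_psi pol_eval_lin_ext lin_ext_def monomial_fun_psi)
  have "(\<lambda>n. \<Sum>I\<in>Poly_Mapping.keys P. Poly_Mapping.lookup P I *
      (\<Sum>J\<in>Poly_Mapping.keys Q. Poly_Mapping.lookup Q J * star_summand lam hbar I J n k))
    sums star_rep lam hbar P Q k"
    unfolding star_rep_def lin_ext_def by (intro sums_sum sums_mult star_summand_sums lam)
  moreover have "(\<Sum>I\<in>Poly_Mapping.keys P. Poly_Mapping.lookup P I *
      (\<Sum>J\<in>Poly_Mapping.keys Q. Poly_Mapping.lookup Q J * star_summand lam hbar I J n k))
    = star_coeff lam hbar n
      * (left_field sl2_Y ^^ n) (pol_restrict lam P \<circ> psi lam) k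
      * (left_field sl2_X ^^ n) (pol_restrict lam Q \<circ> psi lam) k" for n
    by (simp add: iter star_summand_def sum_distrib_left sum_distrib_right mult_ac)
  ultimately show ?thesis by simp
qed

text \<open>The series determines the product uniquely because \<open>psi\<close> maps SU(2) onto
  the sphere and elements of \<open>Pol_sphere\<close> are extensional.\<close>

lemma star_eq_pol_restrict:
  assumes lam: "lam > 0" and r: "\<forall>k\<in>SU2. pol_eval r (psi lam k) = star_rep lam hbar P Q k"
  shows "star lam hbar (pol_restrict lam P) (pol_restrict lam Q) = pol_restrict lam r"
proof -
  have suminf: "suminf (\<lambda>n. (-1) ^ n * hbar ^ n
              / (fact n * (\<Prod>j<n. complex_of_real lam - of_nat j * hbar))
            * (left_field sl2_Y ^^ n) (pol_restrict lam P \<circ> psi lam) k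
            * (left_field sl2_X ^^ n) (pol_restrict lam Q \<circ> psi lam) k) = pol_eval r (psi lam k)"
    if "k \<in> SU2" for k
    using star_series_sums[OF lam that, of hbar P Q] r that by (simp add: sums_iff star_coeff_def)
  show ?thesis unfolding star_def
  proof (rule the_equality)
    show "pol_restrict lam r \<in> Pol_sphere lam \<and> (\<forall>k\<in>SU2. (pol_restrict lam r \<circ> psi lam) k =
      suminf (\<lambda>n. (-1) ^ n * hbar ^ n
              / (fact n * (\<Prod>j<n. complex_of_real lam - of_nat j * hbar))
            * (left_field sl2_Y ^^ n) (pol_restrict lam P \<circ> psi lam) k
            * (left_field sl2_X ^^ n) (pol_restrict lam Q \<circ> psi lam) k))"
    proof (intro conjI ballI, rule pol_restrict_in_Pol_sphere)
      fix k assume k: "k \<in> SU2"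
      show "(pol_restrict lam r \<circ> psi lam) k = suminf (\<lambda>n. (-1) ^ n * hbar ^ n
              / (fact n * (\<Prod>j<n. complex_of_real lam - of_nat j * hbar))
            * (left_field sl2_Y ^^ n) (pol_restrict lam P \<circ> psi lam) k
            * (left_field sl2_X ^^ n) (pol_restrict lam Q \<circ> psi lam) k)"
        unfolding suminf[OF k] by (simp add: pol_restrict_psi[OF k])
    qed
  next
    fix s assume s: "s \<in> Pol_sphere lam \<and> (\<forall>k\<in>SU2. (s \<circ> psi lam) k =
      suminf (\<lambda>n. (-1) ^ n * hbar ^ n
              / (fact n * (\<Prod>j<n. complex_of_real lam - of_nat j * hbar))
            * (left_field sl2_Y ^^ n) (pol_restrict lam P \<circ> psi lam) k
            * (left_field sl2_X ^^ n) (pol_restrict lam Q \<circ> psi lam) k))"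
    then obtain q where q: "s = pol_restrict lam q" by (auto simp: Pol_sphere_eq)
    have "s (psi lam k) = pol_eval r (psi lam k)" if "k \<in> SU2" for k
      using bspec[OF conjunct2[OF s] that] unfolding suminf[OF that] by simp
    then show "s = pol_restrict lam r"
      unfolding q pol_restrict_eq_iff by (simp add: pol_restrict_psi)
  qed
qed

lemma topspace_quotient_TR_topology: "topspace (quotient_TR_topology lam R) = Pol_sphere lam"
proof -
  have "pol_restrict lam -` Pol_sphere lam = UNIV"
    using pol_restrict_in_Pol_sphere by auto
  moreover have "openin (TR_topology R) (UNIV :: 3 sym_alg set)"
    unfolding openin_TR_topology by (auto intro: exI[of _ 1])
  ultimately have "openin (quotient_TR_topology lam R) (Pol_sphere lam)"
    by (simp add: openin_quotient_TR_topology)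
  then show ?thesis
    by (metis openin_quotient_TR_topology openin_subset openin_topspace subset_antisym)
qed

text \<open>The restriction map is open: the preimage of the image of a ball is a union of
  translates of that ball by polynomials vanishing on the sphere.\<close>

lemma openin_quotient_ball:
  assumes "C \<ge> 1"
  shows "openin (quotient_TR_topology lam R) (pol_restrict lam ` {q. TR_norm R C (q - p) < e})"
    (is "openin _ (_ ` ?B)")
  unfolding openin_quotient_TR_topology openin_TR_topology
proof (intro conjI ballI)
  show "pol_restrict lam ` ?B \<subseteq> Pol_sphere lam"
    using pol_restrict_in_Pol_sphere by auto
  fix x assume "x \<in> pol_restrict lam -` (pol_restrict lam ` ?B)"
  then obtain b where b: "TR_norm R C (b - p) < e" "pol_restrict lam x = pol_restrict lam b" by auto
  have "y \<in> pol_restrict lam -` (pol_restrict lam ` ?B)"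
    if y: "TR_norm R C (y - x) < e - TR_norm R C (b - p)" for y
  proof -
    \<comment> \<open>Adding \<open>b - x\<close>, which vanishes on the sphere, moves
      \<open>y\<close> into the ball without changing its restriction.\<close>
    have "pol_restrict lam y = pol_restrict lam (y - x + b)"
      using b(2) unfolding pol_restrict_eq_iff
      by (simp add: pol_eval_lin_ext lin_ext_add lin_ext_diff)
    moreover have "TR_norm R C (y - x + b - p) < e"
      using TR_norm_add[of C R "y - x" "b - p"] y assms by (simp add: algebra_simps)
    ultimately show ?thesis by blast
  qed
  then show "\<exists>C\<ge>1. \<exists>e>0. \<forall>y. TR_norm R C (y - x) < e \<longrightarrow> y \<in> pol_restrict lam -` (pol_restrict lam ` ?B)"
    using assms b(1) by (intro exI[of _ C] conjI exI[of _ "e - TR_norm R C (b - p)"]) auto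
qed

theorem mainTheorem2:
  fixes lam R :: real and hbar :: complex
  assumes "lam > 0" and "hbar \<noteq> 0" and "complex_of_real lam / hbar \<notin> \<nat>" and "R \<ge> 0"
  shows "continuous_map
    (prod_topology (quotient_TR_topology lam R) (quotient_TR_topology lam R))
    (quotient_TR_topology lam R)
    (\<lambda>(p, q). star lam hbar p q)"
proof -
  let ?Q = "quotient_TR_topology lam R" and ?\<pi> = "pol_restrict lam"
  have star: "\<exists>r. star lam hbar (?\<pi> P) (?\<pi> Q) = ?\<pi> r
      \<and> (\<forall>k\<in>SU2. pol_eval r (psi lam k) = star_rep lam hbar P Q k)" for P Q
  proof -
    obtain C where "C \<ge> 1" "\<And>P Q. \<exists>r. (\<forall>k\<in>SU2. pol_eval r (psi lam k) = star_rep lam hbar P Q k)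
        \<and> TR_norm R 1 r \<le> TR_norm R C P * TR_norm R C Q"
      by (rule star_rep_bound[OF assms order_refl[of 1]]) (rule that)
    then obtain r where "\<forall>k\<in>SU2. pol_eval r (psi lam k) = star_rep lam hbar P Q k" by blast
    with star_eq_pol_restrict[OF assms(1)] show ?thesis by blast
  qed
  have nbhd: "\<exists>V W. openin ?Q V \<and> openin ?Q W \<and> ?\<pi> P \<in> V \<and> ?\<pi> Q \<in> W
      \<and> V \<times> W \<subseteq> {x \<in> Pol_sphere lam \<times> Pol_sphere lam. (case x of (p, q) \<Rightarrow> star lam hbar p q) \<in> U}"
    if U: "openin ?Q U" and PQ: "star lam hbar (?\<pi> P) (?\<pi> Q) \<in> U" for U P Q
  proof -
    obtain r where r: "star lam hbar (?\<pi> P) (?\<pi> Q) = ?\<pi> r"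
      "\<And>k. k \<in> SU2 \<Longrightarrow> pol_eval r (psi lam k) = star_rep lam hbar P Q k"
      using star[of P Q] by blast
    have r_U: "r \<in> ?\<pi> -` U" using r PQ by auto
    obtain C e where C: "C \<ge> 1" "e > 0" "\<And>q. TR_norm R C (q - r) < e \<Longrightarrow> ?\<pi> q \<in> U"
      using bspec[OF conjunct2[OF U[unfolded openin_quotient_TR_topology openin_TR_topology]] r_U]
      by auto
    obtain C' where C': "C' \<ge> 1" "\<And>P Q. \<exists>r. (\<forall>k\<in>SU2. pol_eval r (psi lam k) = star_rep lam hbar P Q k)
        \<and> TR_norm R C r \<le> TR_norm R C' P * TR_norm R C' Q"
      by (rule star_rep_bound[OF assms C(1)]) (rule that)
    let ?n = "TR_norm R C'"
    \<comment> \<open>The bound 1 keeps the norm of \<open>Q'\<close> below that of \<open>Q\<close>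
      plus 1; the quotient then makes the two telescoped terms add up to less than
      \<open>e\<close>.\<close>
    define d where "d = min 1 (e / (?n P + ?n Q + 1))"
    have nn: "?n p \<ge> 0" for p using C' by (intro TR_norm_nonneg) auto
    have pos: "0 < ?n P + ?n Q + 1" using nn[of P] nn[of Q] by simp
    have d: "d > 0" "d \<le> 1" using C(2) pos by (auto simp: d_def)
    have de: "d * (?n P + ?n Q + 1) \<le> e"
      unfolding pos_le_divide_eq[OF pos, symmetric] by (simp add: d_def)
    have "star lam hbar (?\<pi> P') (?\<pi> Q') \<in> U" if P': "?n (P' - P) < d" and Q': "?n (Q' - Q) < d" for P' Q'
    proof -
      obtain r1 where r1: "\<And>k. k \<in> SU2 \<Longrightarrow> pol_eval r1 (psi lam k) = star_rep lam hbar (P' - P) Q' k"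
        "TR_norm R C r1 \<le> ?n (P' - P) * ?n Q'" using C'(2)[of "P' - P" Q'] by blast
      obtain r2 where r2: "\<And>k. k \<in> SU2 \<Longrightarrow> pol_eval r2 (psi lam k) = star_rep lam hbar P (Q' - Q) k"
        "TR_norm R C r2 \<le> ?n P * ?n (Q' - Q)" using C'(2)[of P "Q' - Q"] by blast
      \<comment> \<open>The product is represented by \<open>r\<close> plus representatives of the
        two telescoped differences, so its distance from \<open>r\<close> is controlled by
        them.\<close>
      have "star lam hbar (?\<pi> P') (?\<pi> Q') = ?\<pi> (r1 + r2 + r)"
      proof (rule star_eq_pol_restrict[OF assms(1)], rule ballI)
        fix k assume k: "k \<in> SU2"
        show "pol_eval (r1 + r2 + r) (psi lam k) = star_rep lam hbar P' Q' k"
          using r1(1)[OF k] r2(1)[OF k] r(2)[OF k] star_rep_diff[of lam hbar P' Q' k P Q]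
          by (simp add: pol_eval_lin_ext lin_ext_add diff_eq_eq)
      qed
      moreover have "TR_norm R C (r1 + r2 + r - r) < e"
      proof -
        have "?n Q' \<le> ?n (Q' - Q) + ?n Q" using TR_norm_add[of C' R "Q' - Q" Q] C' by simp
        then have Q'1: "?n Q' < ?n Q + 1" using Q' d by simp
        have "TR_norm R C (r1 + r2) \<le> ?n (P' - P) * ?n Q' + ?n P * ?n (Q' - Q)"
          using TR_norm_add[of C R r1 r2] r1(2) r2(2) C by simp
        also have "\<dots> < d * (?n Q + 1) + ?n P * d"
        proof (rule add_less_le_mono)
          show "?n (P' - P) * ?n Q' < d * (?n Q + 1)"
            by (rule mult_strict_mono'[OF P' Q'1 nn nn])
          show "?n P * ?n (Q' - Q) \<le> ?n P * d"
            by (rule mult_left_mono[OF less_imp_le[OF Q'] nn])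
        qed
        also have "\<dots> \<le> e" using de by (simp add: algebra_simps)
        finally show ?thesis by simp
      qed
      ultimately show ?thesis using C(3) by simp
    qed
    \<comment> \<open>Openness of the restriction map makes the images of the two balls
      neighbourhoods in the quotient, so the estimate on representatives carries over to the product
      of the quotient topologies.\<close>
    then have "?\<pi> ` {q. ?n (q - P) < d} \<times> ?\<pi> ` {q. ?n (q - Q) < d}
        \<subseteq> {x \<in> Pol_sphere lam \<times> Pol_sphere lam. (case x of (p, q) \<Rightarrow> star lam hbar p q) \<in> U}"
      by (auto simp: pol_restrict_in_Pol_sphere)
    moreover have "?\<pi> p \<in> ?\<pi> ` {q. ?n (q - p) < d}" for p
      using d by (auto simp: TR_norm_0)
    ultimately show ?thesis
      by (intro exI[of _ "?\<pi> ` {q. ?n (q - P) < d}"] exI[of _ "?\<pi> ` {q. ?n (q - Q) < d}"] conjI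
          openin_quotient_ball C'(1))
  qed
  show ?thesis
    unfolding continuous_map_def topspace_prod_topology topspace_quotient_TR_topology
  proof (intro conjI allI impI)
    show "(\<lambda>(p, q). star lam hbar p q) \<in> Pol_sphere lam \<times> Pol_sphere lam \<rightarrow> Pol_sphere lam"
    proof (clarsimp simp: Pol_sphere_eq)
      fix P Q
      show "star lam hbar (?\<pi> P) (?\<pi> Q) \<in> range ?\<pi>"
        using star[of P Q] by blast
    qed
    show "openin (prod_topology ?Q ?Q)
        {x \<in> Pol_sphere lam \<times> Pol_sphere lam. (case x of (p, q) \<Rightarrow> star lam hbar p q) \<in> U}"
      if "openin ?Q U" for U
      unfolding openin_prod_topology_alt
    proof (intro allI impI)
      fix p q assume pq: "(p, q) \<in> {x \<in> Pol_sphere lam \<times> Pol_sphere lam. (case x of (p, q) \<Rightarrow> star lam hbar p q) \<in> U}"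
      then obtain P Q where p: "p = ?\<pi> P" and q: "q = ?\<pi> Q" unfolding Pol_sphere_eq by auto
      from pq have "star lam hbar (?\<pi> P) (?\<pi> Q) \<in> U" unfolding p q by simp
      from nbhd[OF that this] show "\<exists>V W. openin ?Q V \<and> openin ?Q W \<and> p \<in> V \<and> q \<in> W
          \<and> V \<times> W \<subseteq> {x \<in> Pol_sphere lam \<times> Pol_sphere lam. (case x of (p, q) \<Rightarrow> star lam hbar p q) \<in> U}"
        unfolding p q .
    qed
  qed
qed

end
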